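(* For every non-negative integer $n$ there exist $a,b,c,d\in\mathbb{N}_0$ such that $$n=2a(2a-1)+b(2b-1)+2c(2c+1)+d(2d+1).$$
   Context: $\mathbb{N}_0=\{0,1,2,\dots\}$ denotes the set of non-negative integers. *)

theory Defs
  imports Main
begin

end

theory Submission
  imports Defs
begin

text \<open>
  If \<open>A = 2 (b + d)\<close> and \<open>B = 2 (d - b) + 1\<close> then \<open>4 (b (2 b - 1) + d (2 d + 1)) + 1 = A\<^sup>2 + B\<^sup>2\<close>, so it
  suffices to write \<open>4 n + 3 = A\<^sup>2 + B\<^sup>2 + 2 C\<^sup>2 + 2 D\<^sup>2\<close> with \<open>A\<close>, \<open>C\<close> even, \<open>B\<close>, \<open>D\<close> odd,
  \<open>\<bar>B\<bar> \<le> A + 1\<close> and \<open>\<bar>D\<bar> \<le> C + 1\<close>.  As in Cauchy's proof of the polygonal number theorem, one prescribes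
  the linear form \<open>m = A + 2 C\<close> close to its maximum \<open>sqrt (3 (4 n + 3))\<close>: the remainder
  \<open>3 (4 n + 3) - m\<^sup>2 = 2 (A - C)\<^sup>2 + 3 B\<^sup>2 + 6 D\<^sup>2\<close> is then too small to violate the inequalities, and a
  representation of it by this ternary form comes from one as a sum of three squares.

  That every positive \<open>n \<equiv> 1 (mod 4)\<close> is a sum of three squares follows from a class number relation: for
  \<open>m \<equiv> 1 (mod 4)\<close>, the sum over even \<open>t\<close> of the number of representations of \<open>m - t\<^sup>2\<close> as
  \<open>x\<^sup>2 + y\<^sup>2 + z\<^sup>2\<close> (\<open>x > 0\<close> odd, \<open>y\<close>, \<open>z\<close> even) and the sum over even \<open>t\<close> of the number of representations
  as \<open>u w - r\<^sup>2\<close> (\<open>r\<close> even, \<open>\<bar>r\<bar> < u, w\<close>) both equal the divisor sum of \<open>m\<close>.  Hence the two numbers of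
  representations agree, and \<open>1 \<cdot> n - 0\<^sup>2\<close> is a representation of the second kind.
\<close>

section \<open>Sums of four odd squares\<close>

definition divisor_pairs :: "int \<Rightarrow> (int \<times> int) set" where
  "divisor_pairs m = {(d, e). 0 < d \<and> 0 < e \<and> d * e = m}"

definition divisor_sum :: "int \<Rightarrow> int" where
  "divisor_sum m = (\<Sum>(d, e)\<in>divisor_pairs m. d)"

lemma finite_divisor_pairs: "finite (divisor_pairs m)"
proof (rule finite_subset)
  show "divisor_pairs m \<subseteq> {0..m} \<times> {0..m}"
  proof
    fix x assume "x \<in> divisor_pairs m"
    then obtain d e where x: "x = (d, e)" "0 < d" "0 < e" "d * e = m"
      by (auto simp: divisor_pairs_def)
    have "d * 1 \<le> d * e" "1 * e \<le> d * e"
      using x by (intro mult_left_mono mult_right_mono; simp)+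
    then show "x \<in> {0..m} \<times> {0..m}" using x by auto
  qed
qed simp

lemma sum_divisor_pairs_swap:
  "(\<Sum>(d, e)\<in>divisor_pairs m. f d e) = (\<Sum>(d, e)\<in>divisor_pairs m. f e d)"
  by (rule sum.reindex_bij_witness[of _ prod.swap prod.swap])
    (auto simp: divisor_pairs_def mult.commute)

lemma abs_le_square_int: "\<bar>x\<bar> \<le> x\<^sup>2" for x :: int
proof (cases "x = 0")
  case False
  then have "\<bar>x\<bar> * 1 \<le> \<bar>x\<bar> * \<bar>x\<bar>" by (intro mult_left_mono) auto
  then show ?thesis by (simp add: power2_eq_square)
qed simp

lemma odd_square_mod_8: "odd x \<Longrightarrow> x\<^sup>2 mod 8 = 1" for x :: int
proof -
  assume "odd x"
  then obtain k where k: "x = 2 * k + 1" by (auto elim: oddE)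
  have "even (k * (k + 1))" by simp
  then obtain j where "k * (k + 1) = 2 * j" by (elim evenE)
  then have "x\<^sup>2 = 8 * j + 1" unfolding k by (simp add: power2_eq_square algebra_simps)
  then show ?thesis by presburger
qed

lemma even_square_mod_4: "even x \<Longrightarrow> x\<^sup>2 mod 4 = 0" for x :: int
  by (auto elim!: evenE simp: power_mult_distrib)

lemma bij_betw_by_inverse:
  assumes "\<And>x. x \<in> A \<Longrightarrow> g (f x) = x \<and> f x \<in> B"
    and "\<And>y. y \<in> B \<Longrightarrow> f (g y) = y \<and> g y \<in> A"
  shows "bij_betw f A B"
  by (rule bij_betw_byWitness[where f' = g]) (simp_all add: assms image_subset_iff)

lemma card_eq_by_inverse:
  assumes "\<And>x. x \<in> A \<Longrightarrow> g (f x) = x \<and> f x \<in> B"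
    and "\<And>y. y \<in> B \<Longrightarrow> f (g y) = y \<and> g y \<in> A"
  shows "card A = card B"
  using bij_betw_by_inverse[of A g f B, OF assms] by (rule bij_betw_same_card)

text \<open>The two factors are both 1 or both 3 mod 4. This later makes
  \<open>(w - u) div 2\<close> even, as the entry \<open>b\<close> of \<open>boxes\<close> must
  be.\<close>

lemma factors_mod_4:
  fixes u w :: int
  assumes "(u * w) mod 4 = 1"
  shows "odd u" "odd w" "4 dvd w - u"
proof -
  have "odd j" if "j mod 4 = 1" for j :: int using that by presburger
  then have "odd (u * w)" using assms by blast
  then show odd: "odd u" "odd w" by simp_all
  have "(u mod 4) * (w mod 4) mod 4 = 1" using assms by (simp add: mod_mult_eq)
  moreover have "u mod 4 = 1 \<or> u mod 4 = 3" "w mod 4 = 1 \<or> w mod 4 = 3"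
    using odd by presburger+
  ultimately show "4 dvd w - u" by (auto, presburger+)
qed

section \<open>A vanishing sum over the solutions of \<open>x^2 + 4 d e = M\<close>, by involutions
  in the style of Zagier\<close>

definition square_plus_product :: "int \<Rightarrow> (int \<times> int \<times> int) set" where
  "square_plus_product M = {(x, d, e). 0 < d \<and> 0 < e \<and> x\<^sup>2 + 4 * d * e = M}"

lemma finite_square_plus_product: "finite (square_plus_product M)"
proof (rule finite_subset)
  show "square_plus_product M \<subseteq> {-M..M} \<times> {0..M} \<times> {0..M}"
  proof
    fix v assume "v \<in> square_plus_product M"
    then obtain x d e where v: "v = (x, d, e)" "0 < d" "0 < e" "x\<^sup>2 + 4 * d * e = M"
      by (auto simp: square_plus_product_def)
    have "d * 1 \<le> d * e" "1 * e \<le> d * e"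
      using v by (intro mult_left_mono mult_right_mono; simp)+
    moreover have "\<bar>x\<bar> \<le> x\<^sup>2" by (rule abs_le_square_int)
    moreover have "0 \<le> x\<^sup>2" by simp
    ultimately have "d \<le> M \<and> e \<le> M \<and> \<bar>x\<bar> \<le> M"
      using v unfolding mult.assoc by linarith
    then show "v \<in> {-M..M} \<times> {0..M} \<times> {0..M}" using v by auto
  qed
qed simp

text \<open>Parity keeps the involutions off their boundaries: \<open>x + e = d\<close> and
  \<open>x + d = e\<close> cannot hold between odd numbers.\<close>

lemma square_plus_product_odd:
  assumes "M mod 8 = 5" and "(x, d, e) \<in> square_plus_product M"
  shows "odd x" "odd d" "odd e"
proof -
  have eq: "x\<^sup>2 + 4 * (d * e) = M" using assms(2) by (simp add: square_plus_product_def)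
  show x: "odd x"
  proof
    assume "even x"
    then have "x\<^sup>2 mod 4 = 0" by (rule even_square_mod_4)
    then show False using eq assms(1) by presburger
  qed
  have "x\<^sup>2 mod 8 = 1" using x by (rule odd_square_mod_8)
  moreover have "odd k" if "a mod 8 = 1" "a + 4 * k = M" for a k :: int
    using that assms(1) by presburger
  ultimately have "odd (d * e)" using eq by blast
  then show "odd d" "odd e" by auto
qed

text \<open>
  The cubic is chosen to be odd under the involution \<open>(x, d, e) \<mapsto> (2 d - x, d, e + x - d)\<close> and to be
  changed in the same way by \<open>x \<mapsto> - x\<close> and by exchanging \<open>d\<close> and \<open>e\<close>; up to a factor it is the only
  such cubic.
\<close>

lemma sum_square_plus_product_cubic:
  assumes M: "M mod 8 = 5"
  defines "g \<equiv> \<lambda>(x, d, e). (x - d) * (x + e) * (d + e)"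
  shows "(\<Sum>v\<in>square_plus_product M. g v) = 0"
proof -
  let ?S = "square_plus_product M"
  let ?U = "{(x, d, e) \<in> ?S. d < x + e}"
  let ?C = "{(x, d, e) \<in> ?S. x + e < d}"
  have fin: "finite ?S" by (rule finite_square_plus_product)
  have "x + e \<noteq> d" if "(x, d, e) \<in> ?S" for x d e
    using square_plus_product_odd[OF M that] by auto
  then have S: "?S = ?U \<union> ?C" by fastforce
  \<comment> \<open>\<open>?U\<close> is where the third entry of the image is positive. The
    involution negates \<open>x - d\<close> and exchanges \<open>x + e\<close> with
    \<open>d + e\<close>.\<close>
  have "(\<Sum>v\<in>?U. g v) = (\<Sum>v\<in>?U. - g v)"
    by (rule sum.reindex_bij_witness[of _ "\<lambda>(x, d, e). (2 * d - x, d, e + x - d)"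
          "\<lambda>(x, d, e). (2 * d - x, d, e + x - d)"])
      (auto simp: g_def square_plus_product_def power2_eq_square algebra_simps)
  then have U: "(\<Sum>v\<in>?U. g v) = 0" by (simp add: sum_negf)
  have "(\<Sum>v\<in>?S. g v) = (\<Sum>v\<in>?U. g v) + (\<Sum>v\<in>?C. g v)"
    by (subst S, rule sum.union_disjoint) (auto intro: finite_subset[OF _ fin])
  then have SC: "(\<Sum>v\<in>?S. g v) = (\<Sum>v\<in>?C. g v)" using U by simp
  \<comment> \<open>Exchanging \<open>d\<close>, \<open>e\<close> and negating \<open>x\<close> both
    carry \<open>g\<close> on \<open>?C\<close> to \<open>?g'\<close>, and the images
    \<open>?C1\<close>, \<open>?C2\<close> fill \<open>?S\<close>. So the sum of \<open>?g'\<close>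
    is twice that of \<open>g\<close>; by the exchange it is also equal to it.\<close>
  let ?g' = "\<lambda>(x, d, e). g (x, e, d)"
  let ?C1 = "{(x, d, e) \<in> ?S. x + d < e}"
  let ?C2 = "{(x, d, e) \<in> ?S. e < x + d}"
  have C1: "(\<Sum>v\<in>?C. g v) = (\<Sum>v\<in>?C1. ?g' v)"
    by (rule sum.reindex_bij_witness[of _ "\<lambda>(x, d, e). (x, e, d)" "\<lambda>(x, d, e). (x, e, d)"])
      (auto simp: g_def square_plus_product_def algebra_simps)
  have C2: "(\<Sum>v\<in>?C. g v) = (\<Sum>v\<in>?C2. ?g' v)"
    by (rule sum.reindex_bij_witness[of _ "\<lambda>(x, d, e). (- x, d, e)" "\<lambda>(x, d, e). (- x, d, e)"])
      (auto simp: g_def square_plus_product_def algebra_simps)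
  have "x + d \<noteq> e" if "(x, d, e) \<in> ?S" for x d e
    using square_plus_product_odd[OF M that] by auto
  then have S': "?S = ?C1 \<union> ?C2" by fastforce
  have "(\<Sum>v\<in>?S. ?g' v) = (\<Sum>v\<in>?C1. ?g' v) + (\<Sum>v\<in>?C2. ?g' v)"
    by (subst S', rule sum.union_disjoint) (auto intro: finite_subset[OF _ fin])
  then have "(\<Sum>v\<in>?S. ?g' v) = 2 * (\<Sum>v\<in>?C. g v)" using C1 C2 by simp
  moreover have "(\<Sum>v\<in>?S. ?g' v) = (\<Sum>v\<in>?S. g v)"
    by (rule sum.reindex_bij_witness[of _ "\<lambda>(x, d, e). (x, e, d)" "\<lambda>(x, d, e). (x, e, d)"])
      (auto simp: g_def square_plus_product_def algebra_simps)
  ultimately show ?thesis using SC by simp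
qed

text \<open>The part of the cubic that is even in \<open>x\<close> is
  \<open>(x^2 - d * e) * (d + e)\<close>, and exchanging \<open>d\<close> and \<open>e\<close>
  splits its sum into two equal halves.\<close>

lemma sum_square_plus_product:
  assumes M: "M mod 8 = 5"
  shows "(\<Sum>(x, d, e)\<in>square_plus_product M. (x\<^sup>2 - d * e) * d) = 0"
proof -
  let ?S = "square_plus_product M"
  define g where "g = (\<lambda>(x, d, e). (x - d) * (x + e) * (d + e) :: int)"
  have g: "(\<Sum>v\<in>?S. g v) = 0"
    using sum_square_plus_product_cubic[OF M] by (simp add: g_def)
  have g': "(\<Sum>(x, d, e)\<in>?S. g (- x, d, e)) = (\<Sum>v\<in>?S. g v)"
    by (rule sum.reindex_bij_witness[of _ "\<lambda>(x, d, e). (- x, d, e)" "\<lambda>(x, d, e). (- x, d, e)"])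
      (auto simp: square_plus_product_def)
  have "(\<Sum>(x, d, e)\<in>?S. 2 * ((x\<^sup>2 - d * e) * (d + e)))
      = (\<Sum>v\<in>?S. g v + (case v of (x, d, e) \<Rightarrow> g (- x, d, e)))"
    by (rule sum.cong) (auto simp: g_def power2_eq_square algebra_simps)
  also have "\<dots> = 0" using g g' by (simp only: sum.distrib)
  finally have "(\<Sum>(x, d, e)\<in>?S. (x\<^sup>2 - d * e) * (d + e)) = 0"
    by (simp add: case_prod_unfold flip: sum_distrib_left)
  moreover have "(\<Sum>(x, d, e)\<in>?S. (x\<^sup>2 - d * e) * (d + e))
     = (\<Sum>(x, d, e)\<in>?S. (x\<^sup>2 - d * e) * d) + (\<Sum>(x, d, e)\<in>?S. (x\<^sup>2 - d * e) * e)"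
    by (simp add: case_prod_unfold distrib_left sum.distrib)
  moreover have "(\<Sum>(x, d, e)\<in>?S. (x\<^sup>2 - d * e) * e) = (\<Sum>(x, d, e)\<in>?S. (x\<^sup>2 - d * e) * d)"
    by (rule sum.reindex_bij_witness[of _ "\<lambda>(x, d, e). (x, e, d)" "\<lambda>(x, d, e). (x, e, d)"])
      (auto simp: square_plus_product_def algebra_simps)
  ultimately show ?thesis by simp
qed

text \<open>The congruences fix the sign of each of the four odd numbers.\<close>

definition four_squares :: "int \<Rightarrow> (int \<times> int \<times> int \<times> int) set" where
  "four_squares m = {(a, b, c, d). a mod 4 = 1 \<and> b mod 4 = 1 \<and> c mod 4 = 1 \<and> d mod 4 = 1 \<and>
     a\<^sup>2 + b\<^sup>2 + c\<^sup>2 + d\<^sup>2 = 4 * m}"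

lemma finite_four_squares: "finite (four_squares m)"
proof (rule finite_subset)
  show "four_squares m \<subseteq> {-4*m..4*m} \<times> {-4*m..4*m} \<times> {-4*m..4*m} \<times> {-4*m..4*m}"
  proof
    fix v assume "v \<in> four_squares m"
    moreover obtain a b c d where "v = (a, b, c, d)" by (cases v)
    ultimately have v: "v = (a, b, c, d)" "a\<^sup>2 + b\<^sup>2 + c\<^sup>2 + d\<^sup>2 = 4 * m"
      by (simp_all add: four_squares_def)
    have "\<bar>a\<bar> \<le> 4 * m" "\<bar>b\<bar> \<le> 4 * m" "\<bar>c\<bar> \<le> 4 * m" "\<bar>d\<bar> \<le> 4 * m"
      using abs_le_square_int[of a] abs_le_square_int[of b] abs_le_square_int[of c]
        abs_le_square_int[of d] v(2) zero_le_power2[of a] zero_le_power2[of b]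
        zero_le_power2[of c] zero_le_power2[of d] by linarith+
    then show "v \<in> {-4*m..4*m} \<times> {-4*m..4*m} \<times> {-4*m..4*m} \<times> {-4*m..4*m}"
      unfolding v(1) by auto
  qed
qed simp

lemma finite_squares_less: "finite {e :: int. P e \<and> e\<^sup>2 < M}"
proof (rule finite_subset)
  show "{e :: int. P e \<and> e\<^sup>2 < M} \<subseteq> {-M..M}"
  proof
    fix e assume "e \<in> {e :: int. P e \<and> e\<^sup>2 < M}"
    then show "e \<in> {-M..M}" using abs_le_square_int[of e] by auto
  qed
qed simp

text \<open>
  The next two recurrences are coefficient identities for \<open>\<psi> Y' = 4 \<psi>' Y\<close>, which determines
  \<open>Y = \<psi>\<^sup>4\<close> for the theta series \<open>\<psi>\<close> of the odd squares.
\<close>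

lemma divisor_sum_recurrence:
  assumes M: "M mod 8 = 5"
  shows "(\<Sum>e | e mod 4 = 1 \<and> e\<^sup>2 < M.
           (e\<^sup>2 - (M - e\<^sup>2) div 4) * divisor_sum ((M - e\<^sup>2) div 4)) = 0"
proof -
  let ?k = "\<lambda>e. (M - e\<^sup>2) div 4"
  let ?f = "\<lambda>e. (e\<^sup>2 - ?k e) * divisor_sum (?k e)"
  let ?X = "{e :: int. e mod 4 = 1 \<and> e\<^sup>2 < M}"
  let ?Y = "{e :: int. e mod 4 = 3 \<and> e\<^sup>2 < M}"
  have k: "4 * ?k e = M - e\<^sup>2" if "odd e" for e :: int
    using odd_square_mod_8[OF that] M by presburger
  have S: "square_plus_product M = Sigma (?X \<union> ?Y) (\<lambda>x. divisor_pairs (?k x))"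
  proof (intro equalityI subsetI)
    fix v assume v: "v \<in> square_plus_product M"
    then obtain x d e where x: "v = (x, d, e)" "0 < d" "0 < e" "x\<^sup>2 + 4 * d * e = M"
      by (auto simp: square_plus_product_def)
    have odd: "odd x" using square_plus_product_odd(1)[OF M] v x by blast
    have "0 < d * e" using x by simp
    then have "x\<^sup>2 < M" using x by linarith
    moreover have "d * e = ?k x" using k[OF odd] x by linarith
    moreover have "x mod 4 = 1 \<or> x mod 4 = 3" using odd by presburger
    ultimately show "v \<in> Sigma (?X \<union> ?Y) (\<lambda>x. divisor_pairs (?k x))"
      using x by (auto simp: divisor_pairs_def)
  next
    fix v assume "v \<in> Sigma (?X \<union> ?Y) (\<lambda>x. divisor_pairs (?k x))"
    then obtain x d e where x: "v = (x, d, e)" "x mod 4 = 1 \<or> x mod 4 = 3"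
      "0 < d" "0 < e" "d * e = ?k x" by (auto simp: divisor_pairs_def)
    have "odd x" using x(2) by presburger
    then have "x\<^sup>2 + 4 * d * e = M" using k[of x] x by (simp add: mult.assoc)
    then show "v \<in> square_plus_product M" using x by (simp add: square_plus_product_def)
  qed
  have "0 = (\<Sum>(x, y)\<in>square_plus_product M. case y of (d, e) \<Rightarrow> (x\<^sup>2 - d * e) * d)"
    using sum_square_plus_product[OF M] by simp
  also have "\<dots> = (\<Sum>x\<in>?X \<union> ?Y. \<Sum>y\<in>divisor_pairs (?k x). case y of (d, e) \<Rightarrow> (x\<^sup>2 - d * e) * d)"
    unfolding S
    by (rule sum.Sigma[symmetric]) (use finite_squares_less finite_divisor_pairs in auto)
  also have "\<dots> = (\<Sum>x\<in>?X \<union> ?Y. ?f x)"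
  proof (rule sum.cong[OF refl])
    fix x assume "x \<in> ?X \<union> ?Y"
    have "(\<Sum>y\<in>divisor_pairs (?k x). case y of (d, e) \<Rightarrow> (x\<^sup>2 - d * e) * d)
        = (\<Sum>y\<in>divisor_pairs (?k x). (x\<^sup>2 - ?k x) * (case y of (d, e) \<Rightarrow> d))"
      by (rule sum.cong) (auto simp: divisor_pairs_def)
    then show "(\<Sum>y\<in>divisor_pairs (?k x). case y of (d, e) \<Rightarrow> (x\<^sup>2 - d * e) * d) = ?f x"
      by (simp add: divisor_sum_def sum_distrib_left)
  qed
  also have "\<dots> = (\<Sum>x\<in>?X. ?f x) + (\<Sum>x\<in>?Y. ?f x)"
    by (rule sum.union_disjoint) (use finite_squares_less in auto)
  also have "(\<Sum>x\<in>?Y. ?f x) = (\<Sum>x\<in>?X. ?f x)"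
    by (rule sum.reindex_bij_witness[of _ uminus uminus]) (auto, presburger+)
  finally show ?thesis by simp
qed

lemma four_squares_recurrence:
  assumes M: "M mod 8 = 5"
  shows "(\<Sum>e | e mod 4 = 1 \<and> e\<^sup>2 < M.
           (e\<^sup>2 - (M - e\<^sup>2) div 4) * int (card (four_squares ((M - e\<^sup>2) div 4)))) = 0"
proof -
  let ?k = "\<lambda>e. (M - e\<^sup>2) div 4"
  let ?X = "{e :: int. e mod 4 = 1 \<and> e\<^sup>2 < M}"
  let ?F = "{(e, a, b, c, d). e mod 4 = 1 \<and> a mod 4 = 1 \<and> b mod 4 = 1 \<and> c mod 4 = 1 \<and>
     d mod 4 = 1 \<and> e\<^sup>2 + a\<^sup>2 + b\<^sup>2 + c\<^sup>2 + d\<^sup>2 = (M :: int)}"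
  have k: "4 * ?k e = M - e\<^sup>2" if "odd e" for e :: int
    using odd_square_mod_8[OF that] M by presburger
  have F: "?F = Sigma ?X (\<lambda>e. four_squares (?k e))"
  proof (intro equalityI subsetI)
    fix v assume "v \<in> ?F"
    moreover obtain e a b c d where "v = (e, a, b, c, d)" by (cases v)
    ultimately have v: "v = (e, a, b, c, d)" "e mod 4 = 1" "a mod 4 = 1" "b mod 4 = 1"
      "c mod 4 = 1" "d mod 4 = 1" "e\<^sup>2 + a\<^sup>2 + b\<^sup>2 + c\<^sup>2 + d\<^sup>2 = M" by simp_all
    have "odd e" using v(2) by presburger
    then have "a\<^sup>2 + b\<^sup>2 + c\<^sup>2 + d\<^sup>2 = 4 * ?k e" using k[of e] v(7) by simp
    moreover have "0 < a\<^sup>2" using v(3) by auto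
    then have "0 < a\<^sup>2 + b\<^sup>2 + c\<^sup>2 + d\<^sup>2" by (simp add: add_pos_nonneg)
    then have "e\<^sup>2 < M" using v(7) by linarith
    ultimately have "(a, b, c, d) \<in> four_squares (?k e)" "e \<in> ?X"
      using v(2-6) by (simp_all only: four_squares_def mem_Collect_eq prod.case simp_thms)
    then show "v \<in> Sigma ?X (\<lambda>e. four_squares (?k e))" unfolding v(1) by (rule SigmaI[rotated])
  next
    fix v assume "v \<in> Sigma ?X (\<lambda>e. four_squares (?k e))"
    moreover obtain e a b c d where "v = (e, a, b, c, d)" by (cases v)
    ultimately have v: "v = (e, a, b, c, d)" "e mod 4 = 1" "a mod 4 = 1" "b mod 4 = 1"
      "c mod 4 = 1" "d mod 4 = 1" "a\<^sup>2 + b\<^sup>2 + c\<^sup>2 + d\<^sup>2 = 4 * ?k e"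
      by (simp_all add: four_squares_def)
    have "odd e" using v(2) by presburger
    then have "4 * ?k e = M - e\<^sup>2" by (rule k)
    then have "e\<^sup>2 + a\<^sup>2 + b\<^sup>2 + c\<^sup>2 + d\<^sup>2 = M" using v(7) by linarith
    then show "v \<in> ?F" using v(1-6) by simp
  qed
  \<comment> \<open>All five odd squares play symmetric roles in \<open>?F\<close>, while over a
    fixed \<open>e\<close> the other four add up to \<open>4 * ?k e\<close>.\<close>
  have E: "(\<Sum>(e, a, b, c, d)\<in>?F. a\<^sup>2) = (\<Sum>(e, a, b, c, d)\<in>?F. e\<^sup>2)"
    "(\<Sum>(e, a, b, c, d)\<in>?F. b\<^sup>2) = (\<Sum>(e, a, b, c, d)\<in>?F. e\<^sup>2)"
    "(\<Sum>(e, a, b, c, d)\<in>?F. c\<^sup>2) = (\<Sum>(e, a, b, c, d)\<in>?F. e\<^sup>2)"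
    "(\<Sum>(e, a, b, c, d)\<in>?F. d\<^sup>2) = (\<Sum>(e, a, b, c, d)\<in>?F. e\<^sup>2)"
    subgoal by (rule sum.reindex_bij_witness[of _ "\<lambda>(e, a, b, c, d). (a, e, b, c, d)"
        "\<lambda>(e, a, b, c, d). (a, e, b, c, d)"]) auto
    subgoal by (rule sum.reindex_bij_witness[of _ "\<lambda>(e, a, b, c, d). (b, a, e, c, d)"
        "\<lambda>(e, a, b, c, d). (b, a, e, c, d)"]) auto
    subgoal by (rule sum.reindex_bij_witness[of _ "\<lambda>(e, a, b, c, d). (c, a, b, e, d)"
        "\<lambda>(e, a, b, c, d). (c, a, b, e, d)"]) auto
    subgoal by (rule sum.reindex_bij_witness[of _ "\<lambda>(e, a, b, c, d). (d, a, b, c, e)"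
        "\<lambda>(e, a, b, c, d). (d, a, b, c, e)"]) auto
    done
  have "4 * (\<Sum>(e, a, b, c, d)\<in>?F. e\<^sup>2) = (\<Sum>(e, a, b, c, d)\<in>?F. a\<^sup>2) + (\<Sum>(e, a, b, c, d)\<in>?F. b\<^sup>2)
      + (\<Sum>(e, a, b, c, d)\<in>?F. c\<^sup>2) + (\<Sum>(e, a, b, c, d)\<in>?F. d\<^sup>2)"
    unfolding E by simp
  then have "0 = (\<Sum>(e, y)\<in>?F. 4 * e\<^sup>2 - (case y of (a, b, c, d) \<Rightarrow> a\<^sup>2 + b\<^sup>2 + c\<^sup>2 + d\<^sup>2))"
    by (simp only: case_prod_unfold sum.distrib sum_subtractf sum_distrib_left diff_self)
  also have "\<dots> = (\<Sum>e\<in>?X. \<Sum>y\<in>four_squares (?k e).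
      4 * e\<^sup>2 - (case y of (a, b, c, d) \<Rightarrow> a\<^sup>2 + b\<^sup>2 + c\<^sup>2 + d\<^sup>2))"
    unfolding F
    by (rule sum.Sigma[symmetric]) (use finite_squares_less finite_four_squares in auto)
  also have "\<dots> = (\<Sum>e\<in>?X. 4 * ((e\<^sup>2 - ?k e) * int (card (four_squares (?k e)))))"
  proof (rule sum.cong[OF refl])
    fix e assume "e \<in> ?X"
    have "(\<Sum>y\<in>four_squares (?k e). 4 * e\<^sup>2 - (case y of (a, b, c, d) \<Rightarrow> a\<^sup>2 + b\<^sup>2 + c\<^sup>2 + d\<^sup>2))
        = (\<Sum>y\<in>four_squares (?k e). 4 * (e\<^sup>2 - ?k e))"
      by (rule sum.cong) (auto simp: four_squares_def)
    then show "(\<Sum>y\<in>four_squares (?k e). 4 * e\<^sup>2 - (case y of (a, b, c, d) \<Rightarrow> a\<^sup>2 + b\<^sup>2 + c\<^sup>2 + d\<^sup>2))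
        = 4 * ((e\<^sup>2 - ?k e) * int (card (four_squares (?k e))))"
      by simp
  qed
  finally show ?thesis by (simp flip: sum_distrib_left)
qed

lemma square_ge_9: "9 \<le> e\<^sup>2" if "e mod 4 = 1" "e \<noteq> 1" for e :: int
proof -
  have "3 \<le> \<bar>e\<bar>" using that by presburger
  then have "3\<^sup>2 \<le> \<bar>e\<bar>\<^sup>2" by (intro power_mono) auto
  then show ?thesis by simp
qed

text \<open>Jacobi's count of sums of four odd squares: both sides satisfy the same recurrence,
  which determines the value at \<open>m\<close> from smaller odd arguments once
  \<open>m \<noteq> 1\<close>.\<close>

lemma card_four_squares:
  assumes "0 < m" "odd m"
  shows "int (card (four_squares m)) = divisor_sum m"
  using assms
proof (induction "nat m" arbitrary: m rule: less_induct)
  case less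
  show ?case
  proof (cases "m = 1")
    case True
    have "four_squares 1 = {(1, 1, 1, 1)}"
    proof (intro equalityI subsetI)
      fix v assume "v \<in> four_squares 1"
      then obtain a b c d where v: "v = (a, b, c, d)" "a mod 4 = 1" "b mod 4 = 1" "c mod 4 = 1"
        "d mod 4 = 1" "a\<^sup>2 + b\<^sup>2 + c\<^sup>2 + d\<^sup>2 = 4" by (auto simp: four_squares_def)
      have "e = 1" if "e \<in> {a, b, c, d}" for e
      proof (rule ccontr)
        assume "e \<noteq> 1"
        then have "9 \<le> e\<^sup>2" using that v by (intro square_ge_9) auto
        then show False using that v(6) zero_le_power2[of a] zero_le_power2[of b]
          zero_le_power2[of c] zero_le_power2[of d] by fastforce
      qed
      then show "v \<in> {(1, 1, 1, 1)}" using v(1) by simp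
    qed (simp add: four_squares_def)
    moreover have "divisor_pairs 1 = {(1, 1)}"
      by (auto simp: divisor_pairs_def zmult_eq_1_iff)
    ultimately show ?thesis using True by (simp add: divisor_sum_def)
  next
    case False
    \<comment> \<open>With this \<open>M\<close>, the term \<open>e = 1\<close> has index
      \<open>m\<close> and the nonzero coefficient \<open>1 - m\<close>; every other
      \<open>e\<close> has \<open>e^2 \<ge> 9\<close>, hence a smaller index.\<close>
    define M where "M = 4 * m + 1"
    define X where "X = {e :: int. e mod 4 = 1 \<and> e\<^sup>2 < M}"
    define k where "k = (\<lambda>e :: int. (M - e\<^sup>2) div 4)"
    define D where "D = (\<lambda>e. int (card (four_squares (k e))) - divisor_sum (k e))"
    have M: "M mod 8 = 5" using less.prems(2) unfolding M_def by presburger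
    have "(\<Sum>e\<in>X. (e\<^sup>2 - k e) * D e) = 0"
      using divisor_sum_recurrence[OF M] four_squares_recurrence[OF M]
      by (simp add: D_def X_def k_def right_diff_distrib sum_subtractf)
    moreover have "finite X" unfolding X_def by (rule finite_squares_less)
    moreover have "1 \<in> X" using less.prems by (simp add: X_def M_def)
    moreover have "D e = 0" if e: "e \<in> X - {1}" for e
    proof -
      have e': "e mod 4 = 1" "e \<noteq> 1" "e\<^sup>2 < M" using e by (auto simp: X_def)
      have "odd e" using e'(1) by presburger
      then have "e\<^sup>2 mod 8 = 1" by (rule odd_square_mod_8)
      then have "odd (k e)" "4 * k e = M - e\<^sup>2" using M unfolding k_def by presburger+
      moreover have "9 \<le> e\<^sup>2" using e' by (intro square_ge_9)
      ultimately have "0 < k e" "odd (k e)" "k e < m" using e' M_def by linarith+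
      then show ?thesis using less.hyps[of "k e"] by (simp add: D_def)
    qed
    ultimately have "(1 - k 1) * D 1 = 0" by (simp add: sum.remove[of X 1])
    moreover have "k 1 = m" by (simp add: k_def M_def)
    ultimately show ?thesis using False by (simp add: D_def)
  qed
qed

section \<open>From four odd squares to three squares plus an even square\<close>

definition three_squares :: "int \<Rightarrow> (int \<times> int \<times> int) set" where
  "three_squares m = {(x, y, z). 0 < x \<and> even y \<and> even z \<and> x\<^sup>2 + y\<^sup>2 + z\<^sup>2 = m}"

definition mixed_squares :: "int \<Rightarrow> (int \<times> int \<times> int \<times> int) set" where
  "mixed_squares m = {(t, x, y, z). even t \<and> (x, y, z) \<in> three_squares (m - t\<^sup>2)}"

lemma finite_three_squares: "finite (three_squares m)"
proof (rule finite_subset)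
  show "three_squares m \<subseteq> {-m..m} \<times> {-m..m} \<times> {-m..m}"
  proof
    fix v assume "v \<in> three_squares m"
    moreover obtain x y z where "v = (x, y, z)" by (cases v)
    ultimately have v: "v = (x, y, z)" "x\<^sup>2 + y\<^sup>2 + z\<^sup>2 = m"
      by (simp_all add: three_squares_def)
    have "\<bar>x\<bar> \<le> m" "\<bar>y\<bar> \<le> m" "\<bar>z\<bar> \<le> m"
      using abs_le_square_int[of x] abs_le_square_int[of y] abs_le_square_int[of z] v(2)
        zero_le_power2[of x] zero_le_power2[of y] zero_le_power2[of z] by linarith+
    then show "v \<in> {-m..m} \<times> {-m..m} \<times> {-m..m}" unfolding v(1) by auto
  qed
qed simp

lemma card_mixed_squares:
  "card (mixed_squares m) = (\<Sum>t | even t \<and> t\<^sup>2 < m. card (three_squares (m - t\<^sup>2)))"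
proof -
  let ?T = "{t :: int. even t \<and> t\<^sup>2 < m}"
  have "t\<^sup>2 < m" if "(x, y, z) \<in> three_squares (m - t\<^sup>2)" for t x y z
  proof -
    have "0 < x\<^sup>2" "x\<^sup>2 + y\<^sup>2 + z\<^sup>2 = m - t\<^sup>2" using that by (auto simp: three_squares_def)
    then show ?thesis using zero_le_power2[of y] zero_le_power2[of z] by linarith
  qed
  then have "mixed_squares m = (SIGMA t:?T. three_squares (m - t\<^sup>2))"
    unfolding mixed_squares_def by fastforce
  then show ?thesis
    using card_SigmaI[of ?T "\<lambda>t. three_squares (m - t\<^sup>2)"] finite_squares_less[of even m]
      finite_three_squares by auto
qed

text \<open>The four linear forms are the rows of a Hadamard matrix of order 4.\<close>

lemma sum_four_squares_half:
  "(x + y + z + t)\<^sup>2 + (x + y - z - t)\<^sup>2 + (x - y + z - t)\<^sup>2 + (x - y - z + t)\<^sup>2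
     = 4 * (x\<^sup>2 + y\<^sup>2 + z\<^sup>2 + t\<^sup>2)" for x y z t :: int
  by (simp add: power2_eq_square algebra_simps)

lemma mod_4_shift:
  "(w + a + b) mod 4 = 1 \<Longrightarrow> even a \<Longrightarrow> even b \<Longrightarrow> (w - a - b) mod 4 = 1" for w a b :: int
  by presburger

text \<open>The Hadamard transform is the bijection. The sign of \<open>x\<close>, free on one side,
  is spent on making all four odd numbers 1 mod 4.\<close>

lemma card_mixed_squares_eq_four_squares:
  assumes m: "m mod 4 = 1"
  shows "card (mixed_squares m) = card (four_squares m)"
proof -
  define f :: "int \<times> int \<times> int \<times> int \<Rightarrow> int \<times> int \<times> int \<times> int" where
    "f = (\<lambda>(t, x, y, z). let x' = if (x + y + z + t) mod 4 = 1 then x else - x in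
       (x' + y + z + t, x' + y - z - t, x' - y + z - t, x' - y - z + t))"
  define g :: "int \<times> int \<times> int \<times> int \<Rightarrow> int \<times> int \<times> int \<times> int" where
    "g = (\<lambda>(a, b, c, d). ((a - b - c + d) div 4, \<bar>(a + b + c + d) div 4\<bar>,
       (a + b - c - d) div 4, (a - b + c - d) div 4))"
  have fg: "g (f v) = v \<and> f v \<in> four_squares m" if vm: "v \<in> mixed_squares m" for v
  proof -
    obtain t x y z where v: "v = (t, x, y, z)" by (cases v)
    have h: "even t" "0 < x" "even y" "even z" and eq: "x\<^sup>2 + y\<^sup>2 + z\<^sup>2 = m - t\<^sup>2"
      using vm unfolding v by (simp_all add: mixed_squares_def three_squares_def)
    have ox: "odd x"
    proof
      assume "even x"
      then have "x\<^sup>2 mod 4 = 0" by (rule even_square_mod_4)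
      then show False
        using even_square_mod_4[OF h(1)] even_square_mod_4[OF h(3)] even_square_mod_4[OF h(4)]
          eq m by presburger
    qed
    \<comment> \<open>Negating the odd \<open>x\<close> shifts the sum by 2 mod 4, so exactly one
      sign gives residue 1.\<close>
    define x' where "x' = (if (x + y + z + t) mod 4 = 1 then x else - x)"
    have x': "(x' + y + z + t) mod 4 = 1" using h ox unfolding x'_def by presburger
    have fv: "f v = (x' + y + z + t, x' + y - z - t, x' - y + z - t, x' - y - z + t)"
      unfolding f_def v x'_def Let_def prod.case ..
    have "\<bar>x'\<bar> = x" using h(2) by (simp add: x'_def)
    moreover have "x' + y + z + t - (x' + y - z - t) - (x' - y + z - t) + (x' - y - z + t) = 4 * t"
      "x' + y + z + t + (x' + y - z - t) + (x' - y + z - t) + (x' - y - z + t) = 4 * x'"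
      "x' + y + z + t + (x' + y - z - t) - (x' - y + z - t) - (x' - y - z + t) = 4 * y"
      "x' + y + z + t - (x' + y - z - t) + (x' - y + z - t) - (x' - y - z + t) = 4 * z"
      by simp_all
    ultimately have "g (f v) = v" unfolding fv unfolding g_def prod.case v by simp
    moreover have s: "(x' + z + y + t) mod 4 = 1" "(x' + t + y + z) mod 4 = 1"
      using x' by (simp_all add: add_ac)
    have "(x' + y - z - t) mod 4 = 1" "(x' - y + z - t) mod 4 = 1" "(x' - y - z + t) mod 4 = 1"
      using mod_4_shift[OF x' h(4,1)] mod_4_shift[OF s(1) h(3,1)] mod_4_shift[OF s(2) h(3,4)]
      by (simp_all add: algebra_simps)
    moreover have "x'\<^sup>2 = x\<^sup>2" by (simp add: x'_def)
    then have "(x' + y + z + t)\<^sup>2 + (x' + y - z - t)\<^sup>2 + (x' - y + z - t)\<^sup>2 + (x' - y - z + t)\<^sup>2 = 4 * m"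
      using eq sum_four_squares_half[of x' y z t] by simp
    ultimately show ?thesis using x' unfolding fv by (simp add: four_squares_def)
  qed
  have gf: "f (g v) = v \<and> g v \<in> mixed_squares m" if vm: "v \<in> four_squares m" for v
  proof -
    obtain a b c d where v: "v = (a, b, c, d)" by (cases v)
    have h: "a mod 4 = 1" "b mod 4 = 1" "c mod 4 = 1" "d mod 4 = 1"
      and eq: "a\<^sup>2 + b\<^sup>2 + c\<^sup>2 + d\<^sup>2 = 4 * m"
      using vm unfolding v by (simp_all add: four_squares_def)
    have "\<exists>k. e = 4 * k + 1" if "e mod 4 = 1" for e :: int
      using that by presburger
    then obtain a' b' c' d' where k: "a = 4 * a' + 1" "b = 4 * b' + 1" "c = 4 * c' + 1" "d = 4 * d' + 1"
      using h by metis
    define t where "t = a' - b' - c' + d'"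
    define x where "x = a' + b' + c' + d' + 1"
    define y where "y = a' + b' - c' - d'"
    define z where "z = a' - b' + c' - d'"
    have abcd: "a = x + y + z + t" "b = x + y - z - t" "c = x - y + z - t" "d = x - y - z + t"
      unfolding k t_def x_def y_def z_def by simp_all
    have eq': "x\<^sup>2 + y\<^sup>2 + z\<^sup>2 + t\<^sup>2 = m" using eq sum_four_squares_half[of x y z t] unfolding abcd by simp
    have par: "even y = even t" "even z = even t" "odd x = even t"
      unfolding t_def x_def y_def z_def by simp_all
    \<comment> \<open>If \<open>t\<close> were odd, then \<open>y\<close> and \<open>z\<close> would
      be odd and \<open>x\<close> even, so \<open>m\<close> would be 3 mod 4.\<close>
    have "even t"
    proof (rule ccontr)
      assume "odd t"
      then have "t\<^sup>2 mod 8 = 1" "y\<^sup>2 mod 8 = 1" "z\<^sup>2 mod 8 = 1" "x\<^sup>2 mod 4 = 0"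
        using par by (auto intro: odd_square_mod_8 even_square_mod_4)
      then show False using eq' m by presburger
    qed
    then have e: "even t" "even y" "even z" "odd x" using par by auto
    then have x0: "x \<noteq> 0" by auto
    have gv: "g v = (t, \<bar>x\<bar>, y, z)"
    proof -
      have "a - b - c + d = 4 * t" "a + b + c + d = 4 * x" "a + b - c - d = 4 * y"
        "a - b + c - d = 4 * z" unfolding abcd by simp_all
      then show ?thesis by (simp add: g_def v)
    qed
    have "(if (\<bar>x\<bar> + y + z + t) mod 4 = 1 then \<bar>x\<bar> else - \<bar>x\<bar>) = x"
      using e h(1) unfolding abcd by presburger
    then have "f (g v) = v" unfolding gv unfolding f_def v by (simp add: abcd Let_def)
    moreover have "\<bar>x\<bar>\<^sup>2 + y\<^sup>2 + z\<^sup>2 = m - t\<^sup>2" using eq' by simp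
    ultimately show ?thesis using e x0 unfolding gv
      by (simp add: mixed_squares_def three_squares_def)
  qed
  show ?thesis by (rule card_eq_by_inverse[OF fg gf])
qed

section \<open>A class number relation\<close>

text \<open>Positive binary forms with diagonal entries \<open>u\<close>, \<open>w\<close>,
  off-diagonal entry \<open>r\<close> and determinant \<open>m\<close>. The bound on
  \<open>r\<close> is weaker than Gauss reduction, which asks for \<open>2 * \<bar>r\<bar>\<close>
  at most \<open>u\<close> and \<open>w\<close>.\<close>

definition reduced_forms :: "int \<Rightarrow> (int \<times> int \<times> int) set" where
  "reduced_forms m = {(u, w, r). even r \<and> \<bar>r\<bar> < u \<and> \<bar>r\<bar> < w \<and> u * w - r\<^sup>2 = m}"

definition shifted_forms :: "int \<Rightarrow> (int \<times> int \<times> int \<times> int) set" where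
  "shifted_forms m = {(t, u, w, r). even t \<and> (u, w, r) \<in> reduced_forms (m - t\<^sup>2)}"

lemma reduced_forms_bounds:
  assumes "(u, w, r) \<in> reduced_forms m"
  shows "u \<le> m" "w \<le> m" "0 < u" "0 < w" "\<bar>r\<bar> < m"
proof -
  have h: "\<bar>r\<bar> + 1 \<le> u" "\<bar>r\<bar> + 1 \<le> w" "u * w - r\<^sup>2 = m"
    using assms by (auto simp: reduced_forms_def)
  \<comment> \<open>The aim is \<open>(u - 1) * (w - 1) \<ge> r^2\<close>, that is,
    \<open>u + w - 1 \<le> m\<close>.\<close>
  have "0 \<le> (u - \<bar>r\<bar> - 1) * (w - \<bar>r\<bar> - 1)" using h by simp
  moreover have "0 \<le> \<bar>r\<bar> * (u - \<bar>r\<bar> - 1)" "0 \<le> \<bar>r\<bar> * (w - \<bar>r\<bar> - 1)" using h by simp_all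
  moreover have "\<bar>r\<bar> * \<bar>r\<bar> = r\<^sup>2" by (simp add: power2_eq_square)
  ultimately have "u + w - 1 \<le> u * w - r\<^sup>2" by (simp add: algebra_simps)
  then show "u \<le> m" "w \<le> m" "0 < u" "0 < w" "\<bar>r\<bar> < m" using h by linarith+
qed

lemma finite_reduced_forms: "finite (reduced_forms m)"
proof (rule finite_subset)
  show "reduced_forms m \<subseteq> {0..m} \<times> {0..m} \<times> {-m..m}"
  proof
    fix v assume "v \<in> reduced_forms m"
    moreover obtain u w r where "v = (u, w, r)" by (cases v)
    ultimately show "v \<in> {0..m} \<times> {0..m} \<times> {-m..m}"
      using reduced_forms_bounds[of u w r m] by auto
  qed
qed simp

lemma shifted_forms_Sigma:
  "shifted_forms m = (SIGMA t:{t. even t \<and> t\<^sup>2 < m}. reduced_forms (m - t\<^sup>2))"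
proof -
  have "t\<^sup>2 < m" if "(u, w, r) \<in> reduced_forms (m - t\<^sup>2)" for t u w r
    using reduced_forms_bounds[OF that] by linarith
  then show ?thesis unfolding shifted_forms_def by fastforce
qed

lemma finite_shifted_forms: "finite (shifted_forms m)"
  unfolding shifted_forms_Sigma
  by (rule finite_SigmaI[OF finite_squares_less finite_reduced_forms])

lemma card_shifted_forms_slices:
  "card (shifted_forms m) = (\<Sum>t | even t \<and> t\<^sup>2 < m. card (reduced_forms (m - t\<^sup>2)))"
  unfolding shifted_forms_Sigma
  using card_SigmaI[of "{t. even t \<and> t\<^sup>2 < m}" "\<lambda>t. reduced_forms (m - t\<^sup>2)"]
    finite_squares_less[of even m] finite_reduced_forms by auto

section \<open>Counting the forms with \<open>r < t\<close> by bijections\<close>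

lemma odd_if_odd_square_plus_even: "odd a" if "odd m" "a\<^sup>2 + 2 * k = m" for a k m :: int
  using that by auto

text \<open>Negating \<open>t\<close> and \<open>r\<close> exchanges this half with
  \<open>t < r\<close>; on the diagonal \<open>t = r\<close> the equation is just
  \<open>u * w = m\<close>.\<close>

definition upper_forms :: "int \<Rightarrow> (int \<times> int \<times> int \<times> int) set" where
  "upper_forms m = {(t, u, w, r) \<in> shifted_forms m. r < t}"

text \<open>
  The form \<open>(t, u, w, r)\<close> corresponds to \<open>(a, b, c, i)\<close> with \<open>a = min u w\<close>, \<open>2 b = w - u\<close>, \<open>c = t - r\<close> and
  \<open>i = r + a\<close>; the condition \<open>r < a\<close> turns into \<open>i < 2 a\<close>.  The boxes with \<open>i > 2 a\<close> are counted
  separately and subtracted.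
\<close>

definition boxes :: "int \<Rightarrow> (int \<times> int \<times> int \<times> int) set" where
  "boxes m = {(a, b, c, i). even b \<and> even c \<and> odd i \<and> 0 < a \<and> 0 < c \<and> 0 < i \<and>
     (a - c)\<^sup>2 + 2 * (a * \<bar>b\<bar> + c * i) = m}"

text \<open>Boxes after replacing \<open>a\<close> by \<open>\<bar>a - c\<bar>\<close> and
  \<open>i\<close> by \<open>i + \<bar>b\<bar>\<close>, with \<open>\<epsilon>\<close> the sign of
  \<open>a - c\<close>. For sign -1 the old \<open>a\<close> is \<open>c - a\<close>, whence the
  extra condition \<open>a < c\<close> below.\<close>

definition staircases :: "int \<Rightarrow> int \<Rightarrow> (int \<times> int \<times> int \<times> int) set" where
  "staircases \<epsilon> m = {(a, b, c, d). even b \<and> even c \<and> odd d \<and> 0 < a \<and> 0 < c \<and>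
     \<bar>b\<bar> < d \<and> a\<^sup>2 + 2 * (\<epsilon> * a * \<bar>b\<bar> + c * d) = m}"

lemma finite_boxes: "finite (boxes m)"
proof (rule finite_subset)
  show "boxes m \<subseteq> {0..2*m} \<times> {-m..m} \<times> {0..m} \<times> {0..m}"
  proof
    fix v assume "v \<in> boxes m"
    moreover obtain a b c i where v: "v = (a, b, c, i)" by (cases v)
    ultimately have h: "0 < a" "0 < c" "0 < i" "(a - c)\<^sup>2 + 2 * (a * \<bar>b\<bar> + c * i) = m"
      by (simp_all add: boxes_def)
    have bound: "B \<le> m \<and> c \<le> m \<and> i \<le> m \<and> a \<le> 2 * m"
      if "B \<le> p" "c \<le> q" "i \<le> q" "a - c \<le> s" "0 \<le> s" "0 \<le> B" "s + 2 * (p + q) = m"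
      for B p q s using that h(2) by auto
    have "1 * \<bar>b\<bar> \<le> a * \<bar>b\<bar>" "c * 1 \<le> c * i" "1 * i \<le> c * i"
      using h by (intro mult_left_mono mult_right_mono; simp)+
    moreover have "a - c \<le> (a - c)\<^sup>2" using abs_le_square_int[of "a - c"] by linarith
    ultimately have "\<bar>b\<bar> \<le> m \<and> c \<le> m \<and> i \<le> m \<and> a \<le> 2 * m"
      by (intro bound[OF _ _ _ _ _ _ h(4)]) simp_all
    then show "v \<in> {0..2*m} \<times> {-m..m} \<times> {0..m} \<times> {0..m}" using h v by auto
  qed
qed simp

lemma boxes_odd:
  assumes "odd m" "(a, b, c, i) \<in> boxes m"
  shows "odd a"
proof -
  have "(a - c)\<^sup>2 + 2 * (a * \<bar>b\<bar> + c * i) = m" "even c"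
    using assms(2) by (simp_all add: boxes_def)
  then have "odd (a - c)" "even c" using odd_if_odd_square_plus_even[OF assms(1)] by blast+
  then show ?thesis by simp
qed

lemma card_upper_forms:
  assumes m: "m mod 4 = 1"
  shows "card (upper_forms m) = card {(a, b, c, i) \<in> boxes m. i < 2 * a}"
proof -
  let ?B = "{(a, b, c, i) \<in> boxes m. i < 2 * a}"
  define f :: "int \<times> int \<times> int \<times> int \<Rightarrow> int \<times> int \<times> int \<times> int" where
    "f = (\<lambda>(t, u, w, r). (min u w, (w - u) div 2, t - r, r + min u w))"
  \<comment> \<open>The sign of \<open>b\<close> tells which of \<open>u\<close> and
    \<open>w\<close> is the smaller one, \<open>a\<close>; the other is
    \<open>a + 2 * \<bar>b\<bar>\<close>.\<close>
  define g :: "int \<times> int \<times> int \<times> int \<Rightarrow> int \<times> int \<times> int \<times> int" where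
    "g = (\<lambda>(a, b, c, i). (i - a + c, a + 2 * max 0 (- b), a + 2 * max 0 b, i - a))"
  have om: "odd m" using m by presburger
  have fg: "g (f v) = v \<and> f v \<in> ?B" if vm: "v \<in> upper_forms m" for v
  proof -
    obtain t u w r where v: "v = (t, u, w, r)" by (cases v)
    have h: "even t" "even r" "\<bar>r\<bar> < u" "\<bar>r\<bar> < w" "r < t" and eq: "u * w - r\<^sup>2 = m - t\<^sup>2"
      using vm unfolding v
      by (simp_all add: upper_forms_def shifted_forms_def reduced_forms_def)
    have uw: "(u * w) mod 4 = 1"
      using even_square_mod_4[OF h(1)] even_square_mod_4[OF h(2)] eq m by presburger
    have e: "odd u" "odd w" "4 dvd w - u" using factors_mod_4[OF uw] .
    from e(3) obtain k where k: "w = u + 4 * k" by (metis dvdE add.commute diff_add_cancel)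
    have fv: "f v = (min u w, 2 * k, t - r, r + min u w)" by (simp add: f_def v k)
    have gf: "g (f v) = v" unfolding fv unfolding g_def prod.case v by (simp add: k min_def max_def)
    have "min u w * min u w + 2 * (min u w * \<bar>2 * k\<bar>) = u * w"
      unfolding k by (cases "0 \<le> k") (simp_all add: min_def algebra_simps)
    moreover have "(min u w - (t - r))\<^sup>2 + 2 * (min u w * \<bar>2 * k\<bar> + (t - r) * (r + min u w))
      = (min u w * min u w + 2 * (min u w * \<bar>2 * k\<bar>)) - r\<^sup>2 + t\<^sup>2"
      by (simp add: power2_eq_square algebra_simps)
    ultimately have "(min u w - (t - r))\<^sup>2 + 2 * (min u w * \<bar>2 * k\<bar> + (t - r) * (r + min u w)) = m"
      using eq by simp
    moreover have "odd (min u w)" "\<bar>r\<bar> < min u w" using e h by (auto simp: min_def)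
    ultimately have "f v \<in> ?B" unfolding fv using h by (auto simp: boxes_def)
    then show ?thesis using gf by simp
  qed
  have gf: "f (g v) = v \<and> g v \<in> upper_forms m" if vm: "v \<in> ?B" for v
  proof -
    obtain a b c i where v: "v = (a, b, c, i)" by (cases v)
    have h: "even b" "even c" "odd i" "0 < a" "0 < c" "0 < i" "i < 2 * a"
      and eq: "(a - c)\<^sup>2 + 2 * (a * \<bar>b\<bar> + c * i) = m"
      using vm unfolding v by (simp_all add: boxes_def)
    have oa: "odd a" using boxes_odd[OF om] vm v by blast
    have "(a + 2 * max 0 (- b)) * (a + 2 * max 0 b) = a * a + 2 * (a * \<bar>b\<bar>)"
      by (cases "0 \<le> b") (simp_all add: max_def algebra_simps)
    then have "(a + 2 * max 0 (- b)) * (a + 2 * max 0 b) - (i - a)\<^sup>2 = m - (i - a + c)\<^sup>2"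
      unfolding eq[symmetric] by (simp add: power2_eq_square algebra_simps)
    moreover have "\<bar>i - a\<bar> < a + 2 * max 0 (- b)" "\<bar>i - a\<bar> < a + 2 * max 0 b"
      using h by auto
    ultimately have "g v \<in> upper_forms m" using h oa unfolding v g_def
      by (simp add: upper_forms_def shifted_forms_def reduced_forms_def)
    moreover have "f (g v) = v" unfolding v f_def g_def prod.case
      by (cases "0 \<le> b") (simp_all add: min_def max_def)
    ultimately show ?thesis by simp
  qed
  show ?thesis by (rule card_eq_by_inverse[OF fg gf])
qed

lemma card_boxes_less: "card {(a, b, c, i) \<in> boxes m. c < a} = card (staircases 1 m)"
  and finite_staircases: "finite (staircases 1 m)"
proof -
  have *: "bij_betw (\<lambda>(a, b, c, i). (a - c, b, c, i + \<bar>b\<bar>)) {(a, b, c, i) \<in> boxes m. c < a} (staircases 1 m)"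
    by (rule bij_betw_by_inverse[where g = "\<lambda>(a, b, c, d). (a + c, b, c, d - \<bar>b\<bar>)"])
      (auto simp: boxes_def staircases_def algebra_simps)
  then show "card {(a, b, c, i) \<in> boxes m. c < a} = card (staircases 1 m)"
    by (rule bij_betw_same_card)
  have "finite {(a, b, c, i) \<in> boxes m. c < a}"
    by (rule finite_subset[OF _ finite_boxes[of m]]) auto
  then show "finite (staircases 1 m)" using bij_betw_finite[OF *] by simp
qed

lemma card_boxes_greater:
  "card {(a, b, c, i) \<in> boxes m. a < c} = card {(a, b, c, d) \<in> staircases (- 1) m. a < c}"
  and finite_staircases_neg: "finite {(a, b, c, d) \<in> staircases (- 1) m. a < c}"
proof -
  have *: "bij_betw (\<lambda>(a, b, c, i). (c - a, b, c, i + \<bar>b\<bar>)) {(a, b, c, i) \<in> boxes m. a < c}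
    {(a, b, c, d) \<in> staircases (- 1) m. a < c}"
    by (rule bij_betw_by_inverse[where g = "\<lambda>(a, b, c, d). (c - a, b, c, d - \<bar>b\<bar>)"])
      (auto simp: boxes_def staircases_def algebra_simps power2_commute)
  then show "card {(a, b, c, i) \<in> boxes m. a < c} = card {(a, b, c, d) \<in> staircases (- 1) m. a < c}"
    by (rule bij_betw_same_card)
  have "finite {(a, b, c, i) \<in> boxes m. a < c}"
    by (rule finite_subset[OF _ finite_boxes[of m]]) auto
  then show "finite {(a, b, c, d) \<in> staircases (- 1) m. a < c}"
    using bij_betw_finite[OF *] by simp
qed

text \<open>The boxes with \<open>2 * a < i\<close>, after adding \<open>c\<close> to
  \<open>a\<close> and taking \<open>2 * a + \<bar>b\<bar>\<close> off \<open>i\<close>: the change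
  \<open>4 * a * c\<close> from \<open>(a - c)^2\<close> to \<open>(a + c)^2\<close> is absorbed by
  \<open>c * i\<close>.\<close>

definition tall_staircases :: "int \<Rightarrow> (int \<times> int \<times> int \<times> int) set" where
  "tall_staircases m = {(a, b, c, d). even b \<and> even c \<and> odd d \<and> 0 < c \<and> c < a \<and> - \<bar>b\<bar> < d \<and>
     a\<^sup>2 + 2 * (a * \<bar>b\<bar> + c * d) = m}"

lemma card_boxes_tall:
  "card {(a, b, c, i) \<in> boxes m. 2 * a < i} = card (tall_staircases m)"
  and finite_tall_staircases: "finite (tall_staircases m)"
proof -
  define f :: "int \<times> int \<times> int \<times> int \<Rightarrow> int \<times> int \<times> int \<times> int" where
    "f = (\<lambda>(a, b, c, i). (a + c, b, c, i - 2 * a - \<bar>b\<bar>))"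
  define g :: "int \<times> int \<times> int \<times> int \<Rightarrow> int \<times> int \<times> int \<times> int" where
    "g = (\<lambda>(a, b, c, d). (a - c, b, c, d + \<bar>b\<bar> + 2 * (a - c)))"
  have eq: "(a + c)\<^sup>2 + 2 * ((a + c) * B + c * (i - 2 * a - B)) = (a - c)\<^sup>2 + 2 * (a * B + c * i)"
    for a c i B :: int by (simp add: power2_eq_square algebra_simps)
  have *: "bij_betw f {(a, b, c, i) \<in> boxes m. 2 * a < i} (tall_staircases m)"
  proof (rule bij_betw_by_inverse)
    fix v assume "v \<in> {(a, b, c, i) \<in> boxes m. 2 * a < i}"
    moreover obtain a b c i where v: "v = (a, b, c, i)" by (cases v)
    ultimately have "even b" "even c" "odd i" "0 < a" "0 < c" "2 * a < i"
      and "(a - c)\<^sup>2 + 2 * (a * \<bar>b\<bar> + c * i) = m" by (simp_all add: boxes_def)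
    then show "g (f v) = v \<and> f v \<in> tall_staircases m"
      unfolding v f_def g_def tall_staircases_def prod.case mem_Collect_eq eq by simp
  next
    fix v assume "v \<in> tall_staircases m"
    moreover obtain a b c d where v: "v = (a, b, c, d)" by (cases v)
    ultimately have h: "even b" "even c" "odd d" "0 < c" "c < a" "- \<bar>b\<bar> < d"
      and "a\<^sup>2 + 2 * (a * \<bar>b\<bar> + c * d) = m" by (simp_all add: tall_staircases_def)
    then have "(a - c - c)\<^sup>2 + 2 * ((a - c) * \<bar>b\<bar> + c * (d + \<bar>b\<bar> + 2 * (a - c))) = m"
      using eq[of "a - c" c "\<bar>b\<bar>" "d + \<bar>b\<bar> + 2 * (a - c)"] by simp
    then have "g v \<in> boxes m" using h unfolding v g_def boxes_def prod.case mem_Collect_eq by simp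
    then show "f (g v) = v \<and> g v \<in> {(a, b, c, i) \<in> boxes m. 2 * a < i}"
      using h by (simp add: v f_def g_def)
  qed
  then show "card {(a, b, c, i) \<in> boxes m. 2 * a < i} = card (tall_staircases m)"
    by (rule bij_betw_same_card)
  have "finite {(a, b, c, i) \<in> boxes m. 2 * a < i}"
    by (rule finite_subset[OF _ finite_boxes[of m]]) auto
  then show "finite (tall_staircases m)" using bij_betw_finite[OF *] by simp
qed

definition slopes :: "int \<Rightarrow> int \<Rightarrow> (int \<times> int \<times> int \<times> int) set" where
  "slopes s m = {(a, b, c, d). even b \<and> even c \<and> odd d \<and> 0 < a \<and> a < c \<and> \<bar>b\<bar> < d \<and>
     a\<^sup>2 + 2 * (s * a * b + c * d) = m}"

definition wedges :: "int \<Rightarrow> (int \<times> int \<times> int \<times> int) set" where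
  "wedges m = {(a, b, c, d). even b \<and> even c \<and> odd d \<and> \<bar>c\<bar> < a \<and> 0 < d \<and> d < b \<and>
     a\<^sup>2 + 2 * (a * b + c * d) = m}"

lemma card_eq_add:
  assumes "finite S" "S = A \<union> B" "A \<inter> B = {}"
  shows "card S = card A + card B"
  using assms by (simp add: card_Un_disjoint)

text \<open>Each element is counted equally often on both sides, so unions and intersections
  agree.\<close>

lemma card_add_swap:
  assumes "finite A" "finite B"
    and mem: "\<And>v. (v \<in> A \<longleftrightarrow> v \<in> C) \<and> (v \<in> B \<longleftrightarrow> v \<in> D) \<or> (v \<in> A \<longleftrightarrow> v \<in> D) \<and> (v \<in> B \<longleftrightarrow> v \<in> C)"
  shows "card A + card B = card C + card D" and "finite C"
proof -
  have *: "A \<union> B = C \<union> D" "A \<inter> B = C \<inter> D" using mem by blast+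
  then have "finite C" "finite D" using assms(1,2) by (metis finite_Un)+
  then show "card A + card B = card C + card D" "finite C"
    using card_Un_Int[OF assms(1,2)] card_Un_Int[of C D] * by simp_all
qed

text \<open>The pair of values \<open>\<bar>b\<bar>\<close>, \<open>- \<bar>b\<bar>\<close> is the
  pair \<open>b\<close>, \<open>- b\<close> in some order; then \<open>b \<mapsto> - b\<close>
  identifies the two kinds of slopes.\<close>

lemma card_staircases_slopes:
  "card {(a, b, c, d) \<in> staircases 1 m. a < c} + card {(a, b, c, d) \<in> staircases (- 1) m. a < c}
     = 2 * card (slopes 1 m)"
  and finite_slopes: "finite (slopes 1 m)"
proof -
  let ?P = "\<lambda>\<epsilon>. {(a, b, c, d) \<in> staircases \<epsilon> m. a < c}"
  have fin: "finite (?P 1)" "finite (?P (- 1))"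
    using finite_staircases_neg finite_subset[OF _ finite_staircases[of m], of "?P 1"] by auto
  have mem: "(v \<in> ?P 1 \<longleftrightarrow> v \<in> slopes 1 m) \<and> (v \<in> ?P (- 1) \<longleftrightarrow> v \<in> slopes (- 1) m) \<or>
      (v \<in> ?P 1 \<longleftrightarrow> v \<in> slopes (- 1) m) \<and> (v \<in> ?P (- 1) \<longleftrightarrow> v \<in> slopes 1 m)" for v
  proof -
    obtain a b c d where v: "v = (a, b, c, d)" by (cases v)
    have "\<bar>b\<bar> = b \<or> \<bar>b\<bar> = - b" by linarith
    then show ?thesis
    proof
      assume b: "\<bar>b\<bar> = b"
      show ?thesis by (rule disjI1) (auto simp: v staircases_def slopes_def b)
    next
      assume b: "\<bar>b\<bar> = - b"
      show ?thesis by (rule disjI2) (auto simp: v staircases_def slopes_def b)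
    qed
  qed
  have "card (slopes (- 1) m) = card (slopes 1 m)"
    by (rule card_eq_by_inverse[where f = "\<lambda>(a, b, c, d). (a, - b, c, d)"
          and g = "\<lambda>(a, b, c, d). (a, - b, c, d)"]) (auto simp: slopes_def)
  then show "card (?P 1) + card (?P (- 1)) = 2 * card (slopes 1 m)"
    using card_add_swap(1)[OF fin mem] by simp
  show "finite (slopes 1 m)" by (rule card_add_swap(2)[OF fin mem])
qed

text \<open>
  For fixed \<open>a\<close> and \<open>d\<close> the steps \<open>(b, c) \<mapsto> (b + 2 d, c - 2 a)\<close> preserve \<open>a b + c d\<close>.  A slope has \<open>b\<close> in
  the window \<open>(- d, d)\<close> and \<open>c\<close> to the right of the window \<open>(- a, a)\<close>, a wedge has \<open>c\<close> in its window and \<open>b\<close>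
  to the right of its own; by parity the ends of the windows are never hit.
\<close>

lemma card_slopes_wedges:
  assumes m: "odd m"
  shows "card (slopes 1 m) = card (wedges m)" and "finite (wedges m)"
proof -
  \<comment> \<open>\<open>k\<close> is the number of steps that bring \<open>c\<close> into its
    window; \<open>g\<close> recovers it from the new \<open>b\<close>.\<close>
  define f :: "int \<times> int \<times> int \<times> int \<Rightarrow> int \<times> int \<times> int \<times> int" where
    "f = (\<lambda>(a, b, c, d). let k = (c + a) div (2 * a) in (a, b + 2 * k * d, c - 2 * k * a, d))"
  define g :: "int \<times> int \<times> int \<times> int \<Rightarrow> int \<times> int \<times> int \<times> int" where
    "g = (\<lambda>(a, b, c, d). let k = (b + d) div (2 * d) in (a, b - 2 * k * d, c + 2 * k * a, d))"
  have window: "\<bar>x - 2 * ((x + y) div (2 * y)) * y\<bar> < y" "1 \<le> (x + y) div (2 * y)"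
    if "odd y" "even x" "0 < y" "y < x" for x y :: int
  proof -
    define k r where "k = (x + y) div (2 * y)" and "r = (x + y) mod (2 * y)"
    have kr: "x + y = 2 * y * k + r" by (simp add: k_def r_def)
    have "0 \<le> r" "r < 2 * y" using that by (simp_all add: r_def)
    \<comment> \<open>A zero remainder would put the shifted \<open>x\<close> at the left end
      \<open>- y\<close> of the window.\<close>
    moreover have "odd r" using kr that by (metis even_add even_mult_iff even_numeral)
    then have "r \<noteq> 0" by auto
    ultimately show "\<bar>x - 2 * ((x + y) div (2 * y)) * y\<bar> < y"
      unfolding k_def[symmetric] using kr by (simp add: mult_ac)
    have "(2 * y) div (2 * y) \<le> (x + y) div (2 * y)"
      using that by (intro zdiv_mono1) auto
    then show "1 \<le> (x + y) div (2 * y)" using that by simp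
  qed
  have shift: "(x + 2 * k * y + y) div (2 * y) = k" if "\<bar>x\<bar> < y" for x y k :: int
  proof -
    have "(x + y + k * (2 * y)) div (2 * y) = k + (x + y) div (2 * y)"
      using that by (intro div_mult_self1) auto
    moreover have "(x + y) div (2 * y) = 0" using that by (intro div_pos_pos_trivial) auto
    ultimately show ?thesis by (simp add: algebra_simps)
  qed
  have oa: "odd a" if "a\<^sup>2 + 2 * n = m" for a n using odd_if_odd_square_plus_even[OF m that] .
  have *: "bij_betw f (slopes 1 m) (wedges m)"
  proof (rule bij_betw_by_inverse)
    fix v assume "v \<in> slopes 1 m"
    moreover obtain a b c d where v: "v = (a, b, c, d)" by (cases v)
    ultimately have h: "even b" "even c" "odd d" "0 < a" "a < c" "\<bar>b\<bar> < d"
      and eq: "a\<^sup>2 + 2 * (a * b + c * d) = m" by (simp_all add: slopes_def)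
    define k where "k = (c + a) div (2 * a)"
    have fv: "f v = (a, b + 2 * k * d, c - 2 * k * a, d)" by (simp add: f_def v k_def Let_def)
    have k: "\<bar>c - 2 * k * a\<bar> < a" "1 \<le> k"
      unfolding k_def using window[OF oa[OF eq] h(2,4,5)] by auto
    \<comment> \<open>At least one step is taken, and a single one already carries
      \<open>b > - d\<close> beyond \<open>d\<close>.\<close>
    have "1 * d \<le> k * d" using k(2) h by (intro mult_right_mono) auto
    then have "d < b + 2 * k * d" using h(6) by simp
    moreover have "a\<^sup>2 + 2 * (a * (b + 2 * k * d) + (c - 2 * k * a) * d) = m"
      using eq by (simp add: algebra_simps)
    moreover have "g (f v) = v"
      unfolding fv unfolding g_def prod.case Let_def v shift[OF h(6)] by simp
    ultimately show "g (f v) = v \<and> f v \<in> wedges m"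
      using h k unfolding fv by (simp add: wedges_def)
  next
    fix v assume "v \<in> wedges m"
    moreover obtain a b c d where v: "v = (a, b, c, d)" by (cases v)
    ultimately have h: "even b" "even c" "odd d" "\<bar>c\<bar> < a" "0 < d" "d < b"
      and eq: "a\<^sup>2 + 2 * (a * b + c * d) = m" by (simp_all add: wedges_def)
    define k where "k = (b + d) div (2 * d)"
    have gv: "g v = (a, b - 2 * k * d, c + 2 * k * a, d)" by (simp add: g_def v k_def Let_def)
    have k: "\<bar>b - 2 * k * d\<bar> < d" "1 \<le> k"
      unfolding k_def using window[OF h(3,1,5,6)] by auto
    have "1 * a \<le> k * a" using k(2) h by (intro mult_right_mono) auto
    then have "a < c + 2 * k * a" using h(4) by simp
    moreover have "a\<^sup>2 + 2 * (a * (b - 2 * k * d) + (c + 2 * k * a) * d) = m"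
      using eq by (simp add: algebra_simps)
    moreover have "f (g v) = v"
      unfolding gv unfolding f_def prod.case Let_def v shift[OF h(4)] by simp
    ultimately show "f (g v) = v \<and> g v \<in> slopes 1 m"
      using h k unfolding gv by (simp add: slopes_def)
  qed
  then show "card (slopes 1 m) = card (wedges m)" by (rule bij_betw_same_card)
  show "finite (wedges m)" using bij_betw_finite[OF *] finite_slopes by simp
qed

definition steep_staircases :: "int \<Rightarrow> (int \<times> int \<times> int \<times> int) set" where
  "steep_staircases m = {(a, b, c, d). even b \<and> even c \<and> odd d \<and> 0 < c \<and> c < a \<and> \<bar>d\<bar> < \<bar>b\<bar> \<and>
     a\<^sup>2 + 2 * (a * \<bar>b\<bar> + c * d) = m}"

text \<open>As \<open>b\<close> is even and \<open>d\<close> odd, \<open>- \<bar>b\<bar> < d\<close>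
  splits into \<open>\<bar>b\<bar> < d\<close> and
  \<open>\<bar>d\<bar> < \<bar>b\<bar>\<close>.\<close>

lemma card_tall_staircases:
  "card (tall_staircases m) = card {(a, b, c, d) \<in> staircases 1 m. c < a} + card (steep_staircases m)"
  and finite_steep_staircases: "finite (steep_staircases m)"
proof -
  let ?L = "{(a, b, c, d) \<in> staircases 1 m. c < a}"
  have un: "tall_staircases m = ?L \<union> steep_staircases m"
  proof (intro set_eqI)
    fix v :: "int \<times> int \<times> int \<times> int"
    obtain a b c d where v: "v = (a, b, c, d)" by (cases v)
    have "- \<bar>b\<bar> < d \<longleftrightarrow> \<bar>b\<bar> < d \<or> \<bar>d\<bar> < \<bar>b\<bar>" if "even b" "odd d"
    proof -
      have "d \<noteq> \<bar>b\<bar>" "d \<noteq> - \<bar>b\<bar>" using that by auto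
      then show ?thesis by linarith
    qed
    then show "v \<in> tall_staircases m \<longleftrightarrow> v \<in> ?L \<union> steep_staircases m"
      unfolding v by (auto simp: tall_staircases_def staircases_def steep_staircases_def)
  qed
  show "finite (steep_staircases m)"
    by (rule finite_subset[OF _ finite_tall_staircases[of m]]) (simp add: un)
  show "card (tall_staircases m) = card ?L + card (steep_staircases m)"
    by (rule card_eq_add[OF finite_tall_staircases un])
      (auto simp: steep_staircases_def staircases_def)
qed

text \<open>The sign of \<open>b\<close> accounts for the factor 2; for \<open>b > 0\<close> the
  sign of \<open>d\<close> is moved to \<open>c\<close>.\<close>

lemma card_steep_staircases:
  "card (steep_staircases m) = 2 * card {(a, b, c, d) \<in> wedges m. c \<noteq> 0}"
proof -
  let ?N = "{(a, b, c, d) \<in> steep_staircases m. 0 < b}"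
  let ?N' = "{(a, b, c, d) \<in> steep_staircases m. b < 0}"
  have "card (steep_staircases m) = card ?N + card ?N'"
    by (rule card_eq_add[OF finite_steep_staircases]) (auto simp: steep_staircases_def)
  moreover have "card ?N' = card ?N"
    by (rule card_eq_by_inverse[where f = "\<lambda>(a, b, c, d). (a, - b, c, d)"
          and g = "\<lambda>(a, b, c, d). (a, - b, c, d)"]) (auto simp: steep_staircases_def)
  moreover have "card ?N = card {(a, b, c, d) \<in> wedges m. c \<noteq> 0}"
  proof (rule card_eq_by_inverse)
    fix v assume "v \<in> ?N"
    moreover obtain a b c d where v: "v = (a, b, c, d)" by (cases v)
    ultimately have h: "even b" "even c" "odd d" "0 < c" "c < a" "\<bar>d\<bar> < b" "0 < b"
      and eq: "a\<^sup>2 + 2 * (a * b + c * d) = m" by (auto simp: steep_staircases_def)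
    have "d \<noteq> 0" using h by auto
    then show "(case (case v of (a, b, c, d) \<Rightarrow> (a, b, sgn d * c, \<bar>d\<bar>)) of
          (a, b, c, d) \<Rightarrow> (a, b, \<bar>c\<bar>, sgn c * d)) = v \<and>
        (case v of (a, b, c, d) \<Rightarrow> (a, b, sgn d * c, \<bar>d\<bar>)) \<in> {(a, b, c, d) \<in> wedges m. c \<noteq> 0}"
      using h eq unfolding v by (cases "0 < d") (simp_all add: wedges_def)
  next
    fix v assume "v \<in> {(a, b, c, d) \<in> wedges m. c \<noteq> 0}"
    moreover obtain a b c d where v: "v = (a, b, c, d)" by (cases v)
    ultimately have h: "even b" "even c" "odd d" "\<bar>c\<bar> < a" "0 < d" "d < b" "c \<noteq> 0"
      and eq: "a\<^sup>2 + 2 * (a * b + c * d) = m" by (simp_all add: wedges_def)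
    show "(case (case v of (a, b, c, d) \<Rightarrow> (a, b, \<bar>c\<bar>, sgn c * d)) of
          (a, b, c, d) \<Rightarrow> (a, b, sgn d * c, \<bar>d\<bar>)) = v \<and>
        (case v of (a, b, c, d) \<Rightarrow> (a, b, \<bar>c\<bar>, sgn c * d)) \<in> ?N"
      using h eq unfolding v by (cases "0 < c") (simp_all add: steep_staircases_def)
  qed
  ultimately show ?thesis by simp
qed

text \<open>Subtracting the tall boxes from all boxes cancels the staircases with
  \<open>c < a\<close>. What remains is twice the slopes minus the steep staircases, that is, twice
  all wedges minus twice those with \<open>c \<noteq> 0\<close>.\<close>

lemma card_lower_boxes:
  assumes m: "odd m"
  shows "card {(a, b, c, i) \<in> boxes m. i < 2 * a} = 2 * card {(a, b, c, d) \<in> wedges m. c = 0}"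
proof -
  let ?D = "{(a, b, c, i) \<in> boxes m. i < 2 * a}"
  have "card (boxes m) = card ?D + card {(a, b, c, i) \<in> boxes m. 2 * a < i}"
  proof (rule card_eq_add[OF finite_boxes])
    have "i \<noteq> 2 * a" if "odd i" for a i :: int using that by auto
    then show "boxes m = ?D \<union> {(a, b, c, i) \<in> boxes m. 2 * a < i}"
      by (fastforce simp: boxes_def)
  qed auto
  moreover have "card (boxes m)
      = card {(a, b, c, i) \<in> boxes m. c < a} + card {(a, b, c, i) \<in> boxes m. a < c}"
  proof (rule card_eq_add[OF finite_boxes])
    have "a \<noteq> c" if "(a, b, c, i) \<in> boxes m" for a b c i
      using boxes_odd[OF m that] that by (auto simp: boxes_def)
    then show "boxes m = {(a, b, c, i) \<in> boxes m. c < a} \<union> {(a, b, c, i) \<in> boxes m. a < c}"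
      by fastforce
  qed auto
  moreover have "card (staircases 1 m)
      = card {(a, b, c, d) \<in> staircases 1 m. c < a} + card {(a, b, c, d) \<in> staircases 1 m. a < c}"
  proof (rule card_eq_add[OF finite_staircases])
    have "a \<noteq> c" if "(a, b, c, d) \<in> staircases 1 m" for a b c d
    proof -
      have "a\<^sup>2 + 2 * (1 * a * \<bar>b\<bar> + c * d) = m" "even c"
        using that by (simp_all add: staircases_def)
      then show ?thesis using odd_if_odd_square_plus_even[OF m] by blast
    qed
    then show "staircases 1 m
        = {(a, b, c, d) \<in> staircases 1 m. c < a} \<union> {(a, b, c, d) \<in> staircases 1 m. a < c}"
      by fastforce
  qed auto
  moreover have "card (wedges m)
      = card {(a, b, c, d) \<in> wedges m. c = 0} + card {(a, b, c, d) \<in> wedges m. c \<noteq> 0}"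
    by (rule card_eq_add[OF card_slopes_wedges(2)[OF m]]) auto
  ultimately show ?thesis
    using card_boxes_less[of m] card_boxes_greater[of m] card_boxes_tall[of m]
      card_tall_staircases[of m] card_steep_staircases[of m] card_staircases_slopes[of m]
      card_slopes_wedges(1)[OF m] by linarith
qed

section \<open>Evaluating the counts as a divisor sum\<close>

lemma card_odd_less: "even b \<Longrightarrow> 0 \<le> b \<Longrightarrow> 2 * int (card {d :: int. odd d \<and> 0 < d \<and> d < b}) = b"
proof -
  assume b: "even b" "0 \<le> b"
  then obtain k where k: "b = 2 * k" by (elim evenE)
  have "card {d :: int. odd d \<and> 0 < d \<and> d < b} = card {0..<k}"
    by (rule card_eq_by_inverse[where f = "\<lambda>d. d div 2" and g = "\<lambda>j. 2 * j + 1"])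
      (auto simp: k elim!: oddE)
  then show ?thesis using b k by simp
qed

lemma card_even_abs_less: "odd u \<Longrightarrow> 0 < u \<Longrightarrow> int (card {r :: int. even r \<and> \<bar>r\<bar> < u}) = u"
proof -
  assume u: "odd u" "0 < u"
  then obtain k where k: "u = 2 * k + 1" by (elim oddE)
  have "card {r :: int. even r \<and> \<bar>r\<bar> < u} = card {-k..k}"
    by (rule card_eq_by_inverse[where f = "\<lambda>r. r div 2" and g = "\<lambda>j. 2 * j"])
      (auto simp: k elim!: evenE)
  then show ?thesis using u k by simp
qed

text \<open>For \<open>c = 0\<close> the equation reads \<open>a * (a + 2 * b) = m\<close>. With
  \<open>e = a + 2 * b\<close>, the odd \<open>d\<close> below \<open>b\<close> number
  \<open>(e - a) / 4\<close>.\<close>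

lemma card_wedges_zero:
  assumes m: "m mod 4 = 1"
  shows "4 * int (card {(a, b, c, d) \<in> wedges m. c = 0}) = (\<Sum>(a, e)\<in>divisor_pairs m. max 0 (e - a))"
proof -
  let ?G = "{(a, e) \<in> divisor_pairs m. a < e}"
  let ?O = "\<lambda>(a, e). {d :: int. odd d \<and> 0 < d \<and> d < (e - a) div 2}"
  have finG: "finite ?G" by (rule finite_subset[OF _ finite_divisor_pairs[of m]]) auto
  have G: "even ((e - a) div 2)" "2 * ((e - a) div 2) = e - a" if "(a, e) \<in> divisor_pairs m" for a e
  proof -
    have "(a * e) mod 4 = 1" using that m by (simp add: divisor_pairs_def)
    then have "4 dvd e - a" by (rule factors_mod_4(3))
    then show "even ((e - a) div 2)" "2 * ((e - a) div 2) = e - a" by presburger+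
  qed
  define f :: "int \<times> int \<times> int \<times> int \<Rightarrow> (int \<times> int) \<times> int" where
    "f = (\<lambda>(a, b, c, d). ((a, a + 2 * b), d))"
  define g :: "(int \<times> int) \<times> int \<Rightarrow> int \<times> int \<times> int \<times> int" where
    "g = (\<lambda>((a, e), d). (a, (e - a) div 2, 0, d))"
  have "card {(a, b, c, d) \<in> wedges m. c = 0} = card (Sigma ?G ?O)"
  proof (rule card_eq_by_inverse)
    fix v assume "v \<in> {(a, b, c, d) \<in> wedges m. c = 0}"
    moreover obtain a b c d where v: "v = (a, b, c, d)" by (cases v)
    ultimately have h: "even b" "odd d" "0 < a" "0 < d" "d < b" "c = 0" "a\<^sup>2 + 2 * (a * b) = m"
      by (auto simp: wedges_def)
    then have "(a, a + 2 * b) \<in> divisor_pairs m"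
      by (simp add: divisor_pairs_def power2_eq_square algebra_simps)
    then show "g (f v) = v \<and> f v \<in> Sigma ?G ?O" using h by (simp add: v f_def g_def)
  next
    fix v assume "v \<in> Sigma ?G ?O"
    moreover obtain a e d where v: "v = ((a, e), d)" by (cases v) auto
    ultimately have h: "(a, e) \<in> divisor_pairs m" "a < e" "odd d" "0 < d" "d < (e - a) div 2"
      by auto
    define b where "b = (e - a) div 2"
    have b: "even b" "e = a + 2 * b" using G[OF h(1)] by (simp_all add: b_def)
    have "0 < a" "a * (a + 2 * b) = m" using h(1) b(2) by (simp_all add: divisor_pairs_def)
    then have "(a, b, 0, d) \<in> wedges m" using h b(1) unfolding b_def[symmetric]
      by (simp add: wedges_def power2_eq_square algebra_simps)
    then show "f (g v) = v \<and> g v \<in> {(a, b, c, d) \<in> wedges m. c = 0}"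
      using b(2) by (simp add: v b_def[symmetric] f_def g_def)
  qed
  also have "\<dots> = (\<Sum>p\<in>?G. card (?O p))"
    using finG by (intro card_SigmaI) (auto intro: finite_subset[of _ "{0..<_}"])
  finally have "4 * int (card {(a, b, c, d) \<in> wedges m. c = 0}) = (\<Sum>p\<in>?G. 4 * int (card (?O p)))"
    by (simp add: sum_distrib_left)
  also have "\<dots> = (\<Sum>(a, e)\<in>?G. max 0 (e - a))"
  proof (rule sum.cong[OF refl])
    fix p assume p: "p \<in> ?G"
    obtain a e where ae: "p = (a, e)" by (cases p)
    then have ae': "(a, e) \<in> divisor_pairs m" "a < e" using p by auto
    have "2 * int (card {d :: int. odd d \<and> 0 < d \<and> d < (e - a) div 2}) = (e - a) div 2"
      using G(1)[OF ae'(1)] ae'(2) by (intro card_odd_less) simp_all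
    then show "4 * int (card (?O p)) = (case p of (a, e) \<Rightarrow> max 0 (e - a))"
      using G(2)[OF ae'(1)] ae'(2) by (simp add: ae)
  qed
  also have "\<dots> = (\<Sum>(a, e)\<in>divisor_pairs m. max 0 (e - a))"
    by (rule sum.mono_neutral_left[OF finite_divisor_pairs]) auto
  finally show ?thesis .
qed

text \<open>Given \<open>u * w = m\<close>, the even \<open>r\<close> with
  \<open>\<bar>r\<bar> < min u w\<close> number \<open>min u w\<close>, because this minimum is
  odd.\<close>

lemma card_diagonal_forms:
  assumes m: "m mod 4 = 1"
  shows "int (card {(t, u, w, r) \<in> shifted_forms m. t = r}) = (\<Sum>(u, w)\<in>divisor_pairs m. min u w)"
proof -
  let ?R = "\<lambda>(u, w). {r :: int. even r \<and> \<bar>r\<bar> < min u w}"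
  have "card {(t, u, w, r) \<in> shifted_forms m. t = r} = card (Sigma (divisor_pairs m) ?R)"
    by (rule card_eq_by_inverse[where f = "\<lambda>(t, u, w, r). ((u, w), r)"
          and g = "\<lambda>((u, w), r). (r, u, w, r)"])
      (auto simp: shifted_forms_def reduced_forms_def divisor_pairs_def)
  also have "\<dots> = (\<Sum>p\<in>divisor_pairs m. card (?R p))"
  proof (rule card_SigmaI[OF finite_divisor_pairs], rule ballI)
    fix p
    have "?R p \<subseteq> {- fst p..fst p}" by (cases p) auto
    then show "finite (?R p)" by (rule finite_subset) simp
  qed
  finally have "int (card {(t, u, w, r) \<in> shifted_forms m. t = r})
      = (\<Sum>p\<in>divisor_pairs m. int (card (?R p)))" by simp
  also have "\<dots> = (\<Sum>(u, w)\<in>divisor_pairs m. min u w)"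
  proof (rule sum.cong[OF refl])
    fix p assume p: "p \<in> divisor_pairs m"
    obtain u w where uw: "p = (u, w)" by (cases p)
    have h: "(u * w) mod 4 = 1" "0 < u" "0 < w" using p uw m by (auto simp: divisor_pairs_def)
    have "odd (min u w)" using factors_mod_4(1,2)[OF h(1)] by (simp add: min_def)
    then show "int (card (?R p)) = (case p of (u, w) \<Rightarrow> min u w)"
      using h card_even_abs_less[of "min u w"] by (simp add: uw)
  qed
  finally show ?thesis .
qed

lemma card_shifted_forms:
  assumes m: "m mod 4 = 1"
  shows "int (card (shifted_forms m)) = divisor_sum m"
proof -
  let ?Z = "{(t, u, w, r) \<in> shifted_forms m. t = r}"
  let ?L = "{(t, u, w, r) \<in> shifted_forms m. t < r}"
  have om: "odd m" using m by presburger
  have "card (shifted_forms m) = card ?Z + card (?L \<union> upper_forms m)"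
    by (rule card_eq_add[OF finite_shifted_forms]) (auto simp: upper_forms_def)
  moreover have "card (?L \<union> upper_forms m) = card ?L + card (upper_forms m)"
    by (rule card_eq_add[OF finite_subset[OF _ finite_shifted_forms[of m]]])
      (auto simp: upper_forms_def)
  moreover have "card ?L = card (upper_forms m)"
    by (rule card_eq_by_inverse[where f = "\<lambda>(t, u, w, r). (- t, u, w, - r)"
          and g = "\<lambda>(t, u, w, r). (- t, u, w, - r)"])
      (auto simp: upper_forms_def shifted_forms_def reduced_forms_def)
  moreover have "card (upper_forms m) = 2 * card {(a, b, c, d) \<in> wedges m. c = 0}"
    using card_upper_forms[OF m] card_lower_boxes[OF om] by simp
  ultimately have "int (card (shifted_forms m))
      = int (card ?Z) + 4 * int (card {(a, b, c, d) \<in> wedges m. c = 0})" by simp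
  also have "\<dots> = (\<Sum>(a, e)\<in>divisor_pairs m. min a e) + (\<Sum>(a, e)\<in>divisor_pairs m. max 0 (e - a))"
    using card_diagonal_forms[OF m] card_wedges_zero[OF m] by simp
  \<comment> \<open>After the exchange the summands combine by
    \<open>min a e + max 0 (a - e) = a\<close>.\<close>
  also have "(\<Sum>(a, e)\<in>divisor_pairs m. max 0 (e - a)) = (\<Sum>(a, e)\<in>divisor_pairs m. max 0 (a - e))"
    by (rule sum_divisor_pairs_swap)
  also have "(\<Sum>(a, e)\<in>divisor_pairs m. min a e) + \<dots> = divisor_sum m"
    unfolding divisor_sum_def sum.distrib[symmetric] by (rule sum.cong) auto
  finally show ?thesis .
qed

text \<open>The term \<open>t = 0\<close> of the two equal sums over even \<open>t\<close> is isolated by induction.\<close>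

lemma card_three_squares:
  assumes "n mod 4 = 1"
  shows "card (three_squares n) = card (reduced_forms n)"
  using assms
proof (induction "nat n" arbitrary: n rule: less_induct)
  case less
  show ?case
  proof (cases "0 < n")
    case True
    let ?T = "{t :: int. even t \<and> t\<^sup>2 < n}"
    have fin: "finite ?T" by (rule finite_squares_less)
    have zero: "0 \<in> ?T" using True by simp
    have on: "odd n" using less.prems by presburger
    have "(\<Sum>t\<in>?T. card (three_squares (n - t\<^sup>2))) = (\<Sum>t\<in>?T. card (reduced_forms (n - t\<^sup>2)))"
      using card_mixed_squares[of n] card_mixed_squares_eq_four_squares[OF less.prems]
        card_four_squares[OF True on] card_shifted_forms[OF less.prems]
        card_shifted_forms_slices[of n] by linarith
    moreover have "(\<Sum>t\<in>?T - {0}. card (three_squares (n - t\<^sup>2)))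
        = (\<Sum>t\<in>?T - {0}. card (reduced_forms (n - t\<^sup>2)))"
    proof (rule sum.cong[OF refl])
      fix t assume t: "t \<in> ?T - {0}"
      then have "t\<^sup>2 mod 4 = 0" by (intro even_square_mod_4) simp
      then have "(n - t\<^sup>2) mod 4 = 1" using less.prems by presburger
      moreover have "0 < t\<^sup>2" "t\<^sup>2 < n" using t by auto
      then have "nat (n - t\<^sup>2) < nat n" by linarith
      ultimately show "card (three_squares (n - t\<^sup>2)) = card (reduced_forms (n - t\<^sup>2))"
        using less.hyps by blast
    qed
    ultimately show ?thesis
      using sum.remove[OF fin zero, of "\<lambda>t. card (three_squares (n - t\<^sup>2))"]
        sum.remove[OF fin zero, of "\<lambda>t. card (reduced_forms (n - t\<^sup>2))"] by simp
  next
    case False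
    have "three_squares n = {}"
    proof -
      have "0 < x\<^sup>2 + y\<^sup>2 + z\<^sup>2" if "0 < x" for x y z :: int
        using that by (simp add: add_pos_nonneg)
      then show ?thesis using False unfolding three_squares_def by fastforce
    qed
    moreover have "reduced_forms n = {}"
      using reduced_forms_bounds False by fastforce
    ultimately show ?thesis by simp
  qed
qed

lemma sum_of_three_squares:
  fixes n :: int
  assumes "n mod 4 = 1" "0 < n"
  obtains x y z where "x\<^sup>2 + y\<^sup>2 + z\<^sup>2 = n" "even y" "even z"
proof -
  have "(1, n, 0) \<in> reduced_forms n" using assms by (simp add: reduced_forms_def)
  then have "card (reduced_forms n) \<noteq> 0" using finite_reduced_forms by auto
  then have "three_squares n \<noteq> {}" using card_three_squares[OF assms(1)] by auto
  then obtain x y z where "(x, y, z) \<in> three_squares n" by auto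
  then show ?thesis using that by (auto simp: three_squares_def)
qed

section \<open>Balanced representations\<close>

lemma hexagonal_pair:
  fixes A B :: int
  assumes "even A" "odd B" "\<bar>B\<bar> \<le> A + 1"
  obtains b d :: nat
    where "4 * (int b * (2 * int b - 1) + int d * (2 * int d + 1)) + 1 = A\<^sup>2 + B\<^sup>2"
proof -
  obtain s where s: "A = 2 * s" using assms(1) by (elim evenE)
  obtain u where u: "B = 2 * u + 1" using assms(2) by (elim oddE)
  \<comment> \<open>Passing from \<open>u\<close> to \<open>- u - 1\<close> only changes the sign of
    \<open>B\<close> but flips the parity, so \<open>s - t\<close> can be made even.\<close>
  define t where "t = (if even (s - u) then u else - u - 1)"
  have t: "even (s - t)" "(2 * t + 1)\<^sup>2 = B\<^sup>2"
    by (auto simp: t_def u power2_eq_square algebra_simps)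
  have "\<bar>2 * t + 1\<bar> \<le> 2 * s + 1" using assms(3) by (auto simp: t_def s u)
  \<comment> \<open>The bound on \<open>B\<close> allows \<open>t\<close> from
    \<open>- s - 1\<close> to \<open>s\<close>; parity removes the one value outside
    \<open>\<bar>t\<bar> \<le> s\<close>.\<close>
  moreover have "t \<noteq> - s - 1" using t(1) by auto
  ultimately have ts: "\<bar>t\<bar> \<le> s" by linarith
  obtain b where b: "s - t = 2 * b" using t(1) by (elim evenE)
  define d where "d = t + b"
  have st: "s = b + d" "t = d - b" using b by (simp_all add: d_def)
  have pos: "0 \<le> b" "0 \<le> d" using ts unfolding st by linarith+
  have "4 * (b * (2 * b - 1) + d * (2 * d + 1)) + 1 = A\<^sup>2 + B\<^sup>2"
    unfolding t(2)[symmetric] s st by (simp add: power2_eq_square algebra_simps)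
  then show ?thesis using that[of "nat b" "nat d"] pos by simp
qed

section \<open>The ternary form \<open>2 x^2 + 3 y^2 + 6 z^2\<close>\<close>

lemma three_dvd_mult: "3 dvd a \<or> 3 dvd b" if "3 dvd a * b" for a b :: int
proof -
  have "a mod 3 = 0 \<or> a mod 3 = 1 \<or> a mod 3 = 2" "b mod 3 = 0 \<or> b mod 3 = 1 \<or> b mod 3 = 2"
    by presburger+
  moreover have "(a mod 3) * (b mod 3) mod 3 = 0" using that by (simp add: mod_mult_eq)
  ultimately show ?thesis by auto
qed

lemma square_mod_3: "x\<^sup>2 mod 3 = (if x mod 3 = 0 then 0 else 1)" for x :: int
proof -
  have "x mod 3 = 0 \<or> x mod 3 = 1 \<or> x mod 3 = 2" by presburger
  then show ?thesis using power_mod[of x 3 2] by auto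
qed

text \<open>With such signs a number is congruent to its own square mod 3, so a coordinate sum is
  congruent to the sum of squares.\<close>

lemma exists_sign_mod_3: "\<exists>y. y\<^sup>2 = x\<^sup>2 \<and> even y = even x \<and> y mod 3 = x\<^sup>2 mod 3" for x :: int
proof (cases "x mod 3 = 2")
  case True
  then have "(- x) mod 3 = 1" by presburger
  then show ?thesis using True by (intro exI[of _ "- x"]) (simp add: square_mod_3)
next
  case False
  have "x mod 3 = 0 \<or> x mod 3 = 1 \<or> x mod 3 = 2" by presburger
  then show ?thesis using False by (intro exI[of _ x]) (auto simp: square_mod_3)
qed

text \<open>
  The vectors \<open>(1, 1, 1)\<close>, \<open>(1, -1, 0)\<close>, \<open>(1, 1, -2)\<close> are orthogonal with squared lengths 3, 2, 6, and an integer
  vector lies in their span as soon as its coordinate sum is divisible by 3 and its first two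
  coordinates have the same parity; the residue condition on \<open>n\<close> lets signs be chosen accordingly.
\<close>

lemma represent_2_3_6:
  fixes n :: int
  assumes "n mod 4 = 1" "n mod 3 \<noteq> 1" "0 < n"
  obtains x y z where "2 * x\<^sup>2 + 3 * y\<^sup>2 + 6 * z\<^sup>2 = n"
proof -
  obtain r' p' q' where eq': "r'\<^sup>2 + p'\<^sup>2 + q'\<^sup>2 = n" "even p'" "even q'"
    using sum_of_three_squares[OF assms(1,3)] .
  obtain r where r: "r\<^sup>2 = r'\<^sup>2" "r mod 3 = r'\<^sup>2 mod 3" using exists_sign_mod_3 by blast
  obtain p where p: "p\<^sup>2 = p'\<^sup>2" "even p" "p mod 3 = p'\<^sup>2 mod 3"
    using exists_sign_mod_3 eq' by blast
  obtain q where q: "q\<^sup>2 = q'\<^sup>2" "even q" "q mod 3 = q'\<^sup>2 mod 3"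
    using exists_sign_mod_3 eq' by blast
  have eq: "r\<^sup>2 + p\<^sup>2 + q\<^sup>2 = n" using eq' r p q by simp
  have res: "r mod 3 = 0 \<or> r mod 3 = 1" "p mod 3 = 0 \<or> p mod 3 = 1" "q mod 3 = 0 \<or> q mod 3 = 1"
    using r p q by (simp_all add: square_mod_3)
  define S where "S = r + p + q"
  have S: "S mod 3 = (r mod 3 + p mod 3 + q mod 3) mod 3"
    unfolding S_def by (rule mod_add_cong[OF mod_add_cong]) simp_all
  have "S mod 3 = n mod 3"
    using mod_add_cong[OF mod_add_cong[OF r(2) p(3)] q(3)] eq'(1) by (simp add: S_def)
  \<comment> \<open>If \<open>S\<close> is 2 mod 3, two of the three residues are 1, so
    \<open>r\<close> or \<open>p\<close> has residue 1; negating it makes the sum divisible by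
    3.\<close>
  then have "S mod 3 = 0 \<or> S mod 3 = 2 \<and> (r mod 3 = 1 \<or> p mod 3 = 1)"
    using S res assms(2) by (elim disjE) simp_all
  moreover have "3 dvd S - 2 * j" if "S mod 3 = 2" "j mod 3 = 1" for j
    using that by presburger
  ultimately have "3 dvd S \<or> 3 dvd S - 2 * r \<or> 3 dvd S - 2 * p" by auto
  then have "3 dvd r + p + q \<or> 3 dvd - r + p + q \<or> 3 dvd r - p + q"
    by (simp add: S_def algebra_simps)
  then have "\<exists>R P. R\<^sup>2 = r\<^sup>2 \<and> P\<^sup>2 = p\<^sup>2 \<and> even P \<and> 3 dvd R + P + q"
  proof (elim disjE)
    assume "3 dvd r + p + q"
    then show ?thesis using p(2) by blast
  next
    assume "3 dvd - r + p + q"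
    then show ?thesis using p(2) by (intro exI[of _ "- r"] exI[of _ p]) simp
  next
    assume "3 dvd r - p + q"
    then show ?thesis using p(2) by (intro exI[of _ r] exI[of _ "- p"]) simp
  qed
  then obtain R P where "R\<^sup>2 = r\<^sup>2" "P\<^sup>2 = p\<^sup>2" "even P" "3 dvd R + P + q" by blast
  then have RP: "R\<^sup>2 + P\<^sup>2 + q\<^sup>2 = n" "even P" "3 dvd R + P + q" using eq by simp_all
  have "even (P - q)" using RP(2) q(2) by simp
  then obtain x where x: "P - q = 2 * x" by (elim evenE)
  obtain y where y: "R + P + q = 3 * y" using RP(3) by (elim dvdE)
  \<comment> \<open>\<open>x\<close>, \<open>y\<close>, \<open>z\<close> are the coordinates of
    \<open>(P, q, R)\<close> along \<open>(1, -1, 0)\<close>, \<open>(1, 1, 1)\<close>,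
    \<open>(1, 1, -2)\<close>.\<close>
  define z where "z = x + q - y"
  have z: "P + q - 2 * R = 6 * z" using x y unfolding z_def by presburger
  have RPq: "R = y - 2 * z" "P = x + y + z" "q = y + z - x" using x y z by linarith+
  have "2 * x\<^sup>2 + 3 * y\<^sup>2 + 6 * z\<^sup>2 = n"
    unfolding RP(1)[symmetric] RPq by (simp add: power2_eq_square algebra_simps)
  then show ?thesis by (rule that)
qed

text \<open>\<open>m\<close> is the last term of the progression \<open>2 * n\<close> mod 4 whose
  square stays below the bound. The residue will force the parities of \<open>C\<close> and
  \<open>D\<close>.\<close>

lemma exists_center:
  fixes n :: int
  assumes "133 \<le> n"
  obtains m where "4 dvd m - 2 * n" "36 < m" "m\<^sup>2 < 3 * (4 * n + 3)" "3 * (4 * n + 3) \<le> (m + 4)\<^sup>2"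
proof -
  define r where "r = 2 * n mod 4"
  let ?P = "\<lambda>k. 3 * (4 * n + 3) \<le> (4 * int k + r)\<^sup>2"
  have r: "0 \<le> r" "r \<le> 3" "4 dvd r - 2 * n" unfolding r_def by presburger+
  have "r * r \<le> 3 * 3" using r by (intro mult_mono) auto
  then have "\<not> ?P 0" using assms by (simp add: power2_eq_square)
  moreover have "?P (nat (4 * n + 3))"
  proof -
    define N where "N = 4 * n + 3"
    have "3 * N \<le> N * N" using assms by (intro mult_right_mono) (auto simp: N_def)
    also have "\<dots> \<le> (4 * N + r) * (4 * N + r)"
      using assms r by (intro mult_mono) (auto simp: N_def)
    finally show ?thesis using assms by (simp add: N_def power2_eq_square)
  qed
  ultimately obtain k where k: "\<not> ?P k" "?P (Suc k)"
    using ex_least_nat_less[of ?P] by blast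
  define m where "m = 4 * int k + r"
  have m: "m\<^sup>2 < 3 * (4 * n + 3)" "3 * (4 * n + 3) \<le> (m + 4)\<^sup>2"
    using k by (simp_all add: m_def algebra_simps)
  \<comment> \<open>The threshold 133 comes from
    \<open>3 * (4 * 133 + 3) = 1605 > 40^2\<close>.\<close>
  have "36 < m"
  proof (rule ccontr)
    assume "\<not> 36 < m"
    then have "(m + 4)\<^sup>2 \<le> 40\<^sup>2" using r by (intro power_mono) (auto simp: m_def)
    then show False using m assms by simp
  qed
  moreover have "4 dvd m - 2 * n" using r(3) unfolding m_def by presburger
  ultimately show ?thesis using that m by blast
qed

text \<open>
  By Cauchy--Schwarz both \<open>(3 \<bar>B\<bar> - 2 X)\<^sup>2\<close> and \<open>(3 \<bar>D\<bar> + X)\<^sup>2\<close> are at most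
  \<open>5 (2 X\<^sup>2 + 3 B\<^sup>2 + 6 D\<^sup>2)\<close>, so the two inequalities follow from \<open>5 (3 (4 n + 3) - m\<^sup>2) \<le> (m + 3)\<^sup>2\<close>,
  which holds for \<open>m > 36\<close> and \<open>(m + 4)\<^sup>2 \<ge> 3 (4 n + 3)\<close>.
\<close>

lemma exists_balanced_representation:
  fixes n :: int
  assumes n: "133 \<le> n"
  obtains A B C D where "A\<^sup>2 + B\<^sup>2 + 2 * C\<^sup>2 + 2 * D\<^sup>2 = 4 * n + 3"
    "even A" "odd B" "even C" "odd D" "\<bar>B\<bar> \<le> A + 1" "\<bar>D\<bar> \<le> C + 1"
proof -
  define N where "N = 4 * n + 3"
  obtain m where m: "4 dvd m - 2 * n" "36 < m" "m\<^sup>2 < 3 * N" "3 * N \<le> (m + 4)\<^sup>2"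
    using exists_center[OF n] unfolding N_def .
  define M where "M = 3 * N - m\<^sup>2"
  have em: "even m" using m(1) by presburger
  then have "m\<^sup>2 mod 4 = 0" by (rule even_square_mod_4)
  then have "M mod 4 = 1" unfolding M_def N_def by presburger
  \<comment> \<open>\<open>M\<close> is minus a square mod 3, hence 0 or 2.\<close>
  moreover have "m\<^sup>2 mod 3 = 0 \<or> m\<^sup>2 mod 3 = 1" by (simp add: square_mod_3)
  then have "M mod 3 \<noteq> 1" unfolding M_def by presburger
  ultimately obtain X0 B D where XBD: "2 * X0\<^sup>2 + 3 * B\<^sup>2 + 6 * D\<^sup>2 = M"
    using represent_2_3_6[of M] m(3) by (auto simp: M_def)
  \<comment> \<open>Mod 3 this says that \<open>m\<close> is \<open>X0\<close> up to sign. With the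
    right sign, \<open>C = (m - X) / 3\<close> and \<open>A = X + C\<close> solve
    \<open>A + 2 * C = m\<close>, \<open>A - C = X\<close>.\<close>
  have "3 * (N - B\<^sup>2 - 2 * D\<^sup>2) = m\<^sup>2 + 2 * X0\<^sup>2" using XBD unfolding M_def by simp
  then have "3 dvd m\<^sup>2 + 2 * X0\<^sup>2" by (metis dvd_triv_left)
  then have "3 dvd m\<^sup>2 + 2 * X0\<^sup>2 - 3 * X0\<^sup>2" by (rule dvd_diff) simp
  also have "m\<^sup>2 + 2 * X0\<^sup>2 - 3 * X0\<^sup>2 = (m - X0) * (m + X0)"
    by (simp add: power2_eq_square algebra_simps)
  finally have "3 dvd (m - X0) * (m + X0)" .
  then have "3 dvd m - X0 \<or> 3 dvd m + X0" by (rule three_dvd_mult)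
  then obtain X where X: "X\<^sup>2 = X0\<^sup>2" "3 dvd m - X"
    by (metis diff_minus_eq_add power2_minus)
  then obtain C where C: "m = X + 3 * C" by (metis add.commute diff_add_cancel dvdE)
  define A where "A = X + C"
  have eq: "A\<^sup>2 + B\<^sup>2 + 2 * C\<^sup>2 + 2 * D\<^sup>2 = N"
  proof -
    have "3 * (A\<^sup>2 + 2 * C\<^sup>2) = m\<^sup>2 + 2 * X\<^sup>2"
      by (simp add: A_def C power2_eq_square algebra_simps)
    then show ?thesis using XBD X(1) unfolding M_def by simp
  qed
  have Am: "A = m - 2 * C" by (simp add: A_def C)
  then have eA: "even A" using em by simp
  have oB: "odd B"
  proof
    assume "even B"
    then have "B\<^sup>2 mod 4 = 0" by (rule even_square_mod_4)
    then show False using even_square_mod_4[OF eA] eq unfolding N_def by presburger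
  qed
  then have B8: "B\<^sup>2 mod 8 = 1" by (rule odd_square_mod_8)
  have D4: "D\<^sup>2 mod 4 = 0 \<or> D\<^sup>2 mod 8 = 1"
    using even_square_mod_4 odd_square_mod_8 by blast
  obtain A' where A': "A = 2 * A'" using eA by (elim evenE)
  have A8: "A\<^sup>2 mod 8 = 4 * (A' mod 2)"
  proof -
    have "A\<^sup>2 = 4 * A'\<^sup>2" by (simp add: A' power_mult_distrib)
    moreover have "A'\<^sup>2 mod 2 = A' mod 2"
      using power_mod[of A' 2 2] by (cases "even A'") (auto simp: odd_iff_mod_2_eq_one)
    ultimately show ?thesis using mult_mod_right[of 4 "A'\<^sup>2" 2] by simp
  qed
  \<comment> \<open>The residue of \<open>m\<close> enters here: \<open>A^2\<close> becomes
    \<open>4 * (n + C)\<close> mod 8, and \<open>eq\<close> mod 8 then settles the parities of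
    \<open>C\<close> and \<open>D\<close>.\<close>
  have "2 * (A' + C - n) = m - 2 * n" using Am A' by simp
  then have "even (A' + C - n)" using m(1) by presburger
  then have A'C: "A' mod 2 = (n + C) mod 2" by presburger
  have lift: "\<exists>j. s = k + l * j" if "s mod l = k mod l" for s k l :: int
    using that by (metis mod_eqE minus_mult_right add.commute mult_minus_left diff_conv_add_uminus)
  obtain b where b: "B\<^sup>2 = 1 + 8 * b" using lift[of "B\<^sup>2" 8 1] B8 by auto
  obtain a where a: "A\<^sup>2 = 4 * (n + C) + 8 * a"
  proof -
    have "A\<^sup>2 mod 8 = (4 * (n + C)) mod 8"
      using A8 A'C mult_mod_right[of 4 "n + C" 2] by simp
    then show ?thesis using that lift by blast
  qed
  have D: "(\<exists>d. D\<^sup>2 = 4 * d) \<or> (\<exists>d. D\<^sup>2 = 1 + 8 * d)"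
    using lift[of "D\<^sup>2" 4 0] lift[of "D\<^sup>2" 8 1] D4 by auto
  have eC: "even C"
  proof (rule ccontr)
    assume oC: "odd C"
    then obtain c where c: "C\<^sup>2 = 1 + 8 * c"
      using lift[of "C\<^sup>2" 8 1] odd_square_mod_8 by auto
    obtain k where k: "C = 2 * k + 1" using oC by (elim oddE)
    \<comment> \<open>This would make \<open>D^2\<close> equal to 2 mod 4.\<close>
    have "2 * D\<^sup>2 + 4 + 8 * (k + a + b + 2 * c) = 0"
      using eq unfolding a b c N_def by (simp add: k)
    then show False using D by (elim disjE exE) presburger+
  qed
  have oD: "odd D"
  proof
    assume "even D"
    then obtain d where d: "D\<^sup>2 = 4 * d"
      using lift[of "D\<^sup>2" 4 0] even_square_mod_4 by auto
    obtain c where c: "C\<^sup>2 = 4 * c" using lift[of "C\<^sup>2" 4 0] even_square_mod_4[OF eC] by auto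
    obtain k where k: "C = 2 * k" using eC by (elim evenE)
    have "8 * (k + a + b + c + d) = 2"
      using eq unfolding a b c d N_def by (simp add: k)
    then show False by presburger
  qed
  have M5: "5 * M \<le> (m + 3)\<^sup>2"
  proof -
    \<comment> \<open>Since \<open>5 * M \<le> 5 * ((m + 4)^2 - m^2) = 40 * m + 80\<close>, it
      remains to see \<open>71 \<le> m * (m - 34)\<close>.\<close>
    have "37 * 3 \<le> m * (m - 34)" using m(2) by (intro mult_mono) auto
    then show ?thesis using m(4) unfolding M_def by (simp add: power2_eq_square algebra_simps)
  qed
  have le: "x \<le> m + 3" if "x\<^sup>2 \<le> 5 * M" for x
  proof -
    have "x\<^sup>2 \<le> (m + 3)\<^sup>2" using that M5 by linarith
    then show ?thesis using m(2) by (auto simp: abs_le_square_iff[symmetric])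
  qed
  have M': "M = 2 * X\<^sup>2 + 3 * \<bar>B\<bar>\<^sup>2 + 6 * \<bar>D\<bar>\<^sup>2" using XBD X by simp
  \<comment> \<open>The right-hand side is \<open>5 * M - (3 * \<bar>B\<bar> - 2 * X)^2\<close>; the
    analogous line for \<open>D\<close> has
    \<open>5 * M - (3 * \<bar>D\<bar> + X)^2\<close>.\<close>
  have "0 \<le> 6 * (X + \<bar>B\<bar>)\<^sup>2 + 30 * \<bar>D\<bar>\<^sup>2" by simp
  then have "(3 * \<bar>B\<bar> - 2 * X)\<^sup>2 \<le> 5 * M" unfolding M'
    by (simp only: power2_eq_square) (simp add: algebra_simps)
  then have B_le: "\<bar>B\<bar> \<le> A + 1" using le[of "3 * \<bar>B\<bar> - 2 * X"] unfolding A_def C by simp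
  have "0 \<le> (3 * X - \<bar>D\<bar>)\<^sup>2 + 20 * \<bar>D\<bar>\<^sup>2 + 15 * \<bar>B\<bar>\<^sup>2" by simp
  then have "(3 * \<bar>D\<bar> + X)\<^sup>2 \<le> 5 * M" unfolding M'
    by (simp only: power2_eq_square) (simp add: algebra_simps)
  then have D_le: "\<bar>D\<bar> \<le> C + 1" using le[of "3 * \<bar>D\<bar> + X"] unfolding C by simp
  show ?thesis using that[OF eq[unfolded N_def] eA oB eC oD B_le D_le] .
qed

text \<open>The ranges of \<open>b\<close>, \<open>c\<close>, \<open>d\<close> contain every value
  whose term is at most 132; for \<open>a\<close> the values 0 and 1, with terms 0 and 2,
  suffice.\<close>

lemma small_cases:
  "list_all (\<lambda>n. list_ex (\<lambda>a. list_ex (\<lambda>c. list_ex (\<lambda>b. list_ex (\<lambda>d.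
     n = 2 * a * (2 * a - 1) + b * (2 * b - 1) + 2 * c * (2 * c + 1) + d * (2 * d + 1))
     [0..7]) [0..8]) [0..5]) [0..1]) [0..132 :: int]"
  by code_simp

theorem theorem2:
  fixes n :: nat
  shows "\<exists>a b c d :: nat.
    int n = 2 * int a * (2 * int a - 1) + int b * (2 * int b - 1)
          + 2 * int c * (2 * int c + 1) + int d * (2 * int d + 1)"
proof (cases "n < 133")
  case True
  then have "int n \<in> set [0..132]" by simp
  then obtain a b c d :: int where "0 \<le> a" "0 \<le> b" "0 \<le> c" "0 \<le> d"
    "int n = 2 * a * (2 * a - 1) + b * (2 * b - 1) + 2 * c * (2 * c + 1) + d * (2 * d + 1)"
    using small_cases unfolding list_all_iff list_ex_iff by (metis atLeastAtMost_iff set_upto)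
  then show ?thesis
    by (intro exI[of _ "nat a"] exI[of _ "nat b"] exI[of _ "nat c"] exI[of _ "nat d"]) simp
next
  case False
  then have "133 \<le> int n" by simp
  then obtain A B C D where eq: "A\<^sup>2 + B\<^sup>2 + 2 * C\<^sup>2 + 2 * D\<^sup>2 = 4 * int n + 3"
    and "even A" "odd B" "even C" "odd D" "\<bar>B\<bar> \<le> A + 1" "\<bar>D\<bar> \<le> C + 1"
    by (rule exists_balanced_representation)
  \<comment> \<open>The pair \<open>A\<close>, \<open>B\<close> yields \<open>b\<close>,
    \<open>d\<close>; the doubled squares of \<open>C\<close>, \<open>D\<close> yield the doubled
    terms in \<open>a\<close>, \<open>c\<close>.\<close>
  then obtain a b c d :: nat
    where "4 * (int b * (2 * int b - 1) + int d * (2 * int d + 1)) + 1 = A\<^sup>2 + B\<^sup>2"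
      and "4 * (int a * (2 * int a - 1) + int c * (2 * int c + 1)) + 1 = C\<^sup>2 + D\<^sup>2"
    using hexagonal_pair[of A B] hexagonal_pair[of C D] by metis
  then have "int n = 2 * int a * (2 * int a - 1) + int b * (2 * int b - 1)
      + 2 * int c * (2 * int c + 1) + int d * (2 * int d + 1)"
    using eq by (simp add: algebra_simps)
  then show ?thesis by blast
qed

end
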